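(* Let $D(t)\in\mathbb{Q}[t]$ be a nonconstant polynomial whose Pell equation has a fundamental solution $(u,v)$ with $u,v\in\mathbb{Q}[t]$. For a positive integer $N$ define $$I(N):=\{P(t)\in\mathbb{Q}[t]\ \text{monic irreducible} : \deg P\leq N,\ P(t)\mid v^{\mathrm{new}}_m(t)\text{ for some integer } m\geq 1\}.$$ Then $\# I(N)\leq 10N\deg u$ for all sufficiently large $N$.
   Context: For $D$ nonconstant, Pell's equation for $D$ is $x^2-Dy^2=1$ with $x,y\in\mathbb{C}[t]$. A fundamental solution is a solution $(u,v)$ with $v\neq 0$ of minimal degree among all solutions with $y\neq0$. For integers $n\geq 1$ define $u_n,v_n$ by $u_n+v_n\sqrt{D}=(u+v\sqrt{D})^n$. The "new part" $v^{\mathrm{new}}_n$ of $v_n$ is the polynomial determined by $v_n=\prod_{m\mid n}v^{\mathrm{new}}_m$ for all $n\geq 1$; equivalently $v^{\mathrm{new}}_n=\prod_{m\mid n}v_m^{\mu(n/m)}$, where $\mu$ is the Möbius function. *)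

theory Defs
  imports Complex_Main "HOL-Computational_Algebra.Computational_Algebra"
    "HOL-Computational_Algebra.Field_as_Ring"
begin

definition pell_solution :: "'a::comm_ring_1 poly \<Rightarrow> 'a poly \<Rightarrow> 'a poly \<Rightarrow> bool" where
  "pell_solution D x y \<longleftrightarrow> x ^ 2 - D * y ^ 2 = 1"

text \<open>The degree of a solution \<open>(x, y)\<close> is the degree of \<open>x\<close>. Minimality is over all solutions
  with coefficients in the type \<open>'a\<close>, so for Pell's equation over the complex numbers this is to
  be used at type \<open>complex poly\<close>.\<close>

definition pell_fundamental :: "'a::comm_ring_1 poly \<Rightarrow> 'a poly \<Rightarrow> 'a poly \<Rightarrow> bool" where
  "pell_fundamental D u v \<longleftrightarrow>
     pell_solution D u v \<and> v \<noteq> 0 \<and>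
     (\<forall>x y. pell_solution D x y \<and> y \<noteq> 0 \<longrightarrow> degree u \<le> degree x)"

text \<open>The pair \<open>(a, b)\<close> stands for \<open>a + b * sqrt D\<close>. If \<open>D\<close> is nonconstant and Pell's equation
  has a solution with \<open>y \<noteq> 0\<close>, then \<open>D\<close> is not a square, so this representation is unique.\<close>

definition quad_mult :: "'a::comm_ring_1 poly \<Rightarrow> 'a poly \<times> 'a poly \<Rightarrow> 'a poly \<times> 'a poly \<Rightarrow> 'a poly \<times> 'a poly"
  where "quad_mult D p q =
    (fst p * fst q + D * snd p * snd q, fst p * snd q + snd p * fst q)"

primrec quad_power :: "'a::comm_ring_1 poly \<Rightarrow> 'a poly \<times> 'a poly \<Rightarrow> nat \<Rightarrow> 'a poly \<times> 'a poly" where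
  "quad_power D p 0 = (1, 0)"
| "quad_power D p (Suc n) = quad_mult D (quad_power D p n) p"

definition pell_u :: "'a::comm_ring_1 poly \<Rightarrow> 'a poly \<Rightarrow> 'a poly \<Rightarrow> nat \<Rightarrow> 'a poly" where
  "pell_u D u v n = fst (quad_power D (u, v) n)"

definition pell_v :: "'a::comm_ring_1 poly \<Rightarrow> 'a poly \<Rightarrow> 'a poly \<Rightarrow> nat \<Rightarrow> 'a poly" where
  "pell_v D u v n = snd (quad_power D (u, v) n)"

text \<open>The defining property of the new parts, \<open>v\<^sub>n = (\<Prod>m | m dvd n. v_new m)\<close> for \<open>n \<ge> 1\<close>, solved for
  the factor with \<open>m = n\<close>. The division is exact: see \<open>pell_v_eq_prod_new\<close> and
  \<open>pell_v_new_unique\<close> below. The value at \<open>n = 0\<close> is irrelevant.\<close>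

fun pell_v_new :: "'a::field poly \<Rightarrow> 'a poly \<Rightarrow> 'a poly \<Rightarrow> nat \<Rightarrow> 'a poly" where
  "pell_v_new D u v n =
     pell_v D u v n div (\<Prod>m\<in>{m. m dvd n \<and> m < n}. pell_v_new D u v m)"

declare pell_v_new.simps [simp del]

definition pell_irred :: "'a::field poly \<Rightarrow> 'a poly \<Rightarrow> 'a poly \<Rightarrow> nat \<Rightarrow> 'a poly set" where
  "pell_irred D u v N =
     {P. lead_coeff P = 1 \<and> irreducible P \<and> degree P \<le> N \<and> (\<exists>m\<ge>1. P dvd pell_v_new D u v m)}"


subsection \<open>The new parts are well defined\<close>

lemma pell_Suc:
  "pell_u D u v (Suc n) = pell_u D u v n * u + D * pell_v D u v n * v"
  "pell_v D u v (Suc n) = pell_u D u v n * v + pell_v D u v n * u"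
  by (simp_all add: pell_u_def pell_v_def quad_mult_def)

lemma pell_0: "pell_u D u v 0 = 1" "pell_v D u v 0 = 0"
  by (simp_all add: pell_u_def pell_v_def)

lemma pell_add:
  "pell_u D u v (m + n) = pell_u D u v m * pell_u D u v n + D * pell_v D u v m * pell_v D u v n \<and>
   pell_v D u v (m + n) = pell_u D u v m * pell_v D u v n + pell_v D u v m * pell_u D u v n"
  by (induction n) (simp_all add: pell_0 pell_Suc algebra_simps)

lemma pell_solution_power:
  assumes "pell_solution D u v"
  shows "pell_solution D (pell_u D u v n) (pell_v D u v n)"
proof (induction n)
  case 0
  then show ?case by (simp add: pell_solution_def pell_0)
next
  case (Suc n)
  let ?U = "pell_u D u v n" and ?V = "pell_v D u v n"
  have "pell_u D u v (Suc n) ^ 2 - D * pell_v D u v (Suc n) ^ 2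
      = (?U ^ 2 - D * ?V ^ 2) * (u ^ 2 - D * v ^ 2)"
    by (simp add: pell_Suc algebra_simps power2_eq_square)
  then show ?case
    using Suc assms by (simp add: pell_solution_def)
qed

context
  fixes D u v :: "rat poly"
  assumes D: "degree D > 0" and sol: "pell_solution D u v" and v: "v \<noteq> 0"
begin

private abbreviation "U \<equiv> pell_u D u v"
private abbreviation "V \<equiv> pell_v D u v"

private lemma deg_u: "degree u > 0"
proof (rule ccontr)
  assume "\<not> degree u > 0"
  then have "degree (u ^ 2) = 0"
    by (simp add: degree_power_eq degree_0 power2_eq_square degree_mult_eq_0)
  moreover have "D * v ^ 2 = u ^ 2 - 1"
    using sol unfolding pell_solution_def by (simp add: algebra_simps)
  ultimately have "degree (D * v ^ 2) = 0"
    using degree_diff_le[of "u ^ 2" 0 1] by simp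
  moreover have "degree (D * v ^ 2) = degree D + degree (v ^ 2)"
    using D v by (intro degree_mult_eq) auto
  ultimately show False using D by simp
qed

private lemma V_rec: "V (Suc (Suc n)) = 2 * u * V (Suc n) - V n"
proof -
  have "D * v ^ 2 = u ^ 2 - 1"
    using sol unfolding pell_solution_def by (simp add: algebra_simps)
  then have "D * v ^ 2 * V n = (u ^ 2 - 1) * V n" by simp
  then show ?thesis
    by (simp add: pell_Suc algebra_simps power2_eq_square)
qed

private lemma V_nz_aux: "V (Suc n) \<noteq> 0 \<and> degree (V n) \<le> degree (V (Suc n))"
proof (induction n)
  case 0
  then show ?case using v by (simp add: pell_Suc pell_0)
next
  case (Suc n)
  have "u \<noteq> 0" using deg_u by auto
  then have "degree (2 * u * V (Suc n)) = degree u + degree (V (Suc n))"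
    using Suc by (simp add: degree_mult_eq mult.assoc flip: monom_0 numeral_poly)
  then have *: "degree (V n) < degree (2 * u * V (Suc n))"
    and **: "degree (V (Suc n)) < degree (2 * u * V (Suc n))"
    using deg_u Suc by auto
  have "degree (V (Suc (Suc n))) = degree (2 * u * V (Suc n))"
    unfolding V_rec using degree_add_eq_left[of "- V n" "2 * u * V (Suc n)"] * by simp
  with ** show ?case by auto
qed

private lemma V_nz: "n \<ge> 1 \<Longrightarrow> V n \<noteq> 0"
  using V_nz_aux[of "n - 1"] by simp

private lemma coprime_U_V: "coprime (U n) (V n)"
proof (rule coprimeI)
  fix c assume "c dvd U n" "c dvd V n"
  then have "c dvd U n ^ 2 - D * V n ^ 2"
    by (simp add: power2_eq_square)
  then show "is_unit c"
    using pell_solution_power[OF sol, of n] by (simp add: pell_solution_def)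
qed

private lemma rank_exists: "\<exists>r. \<forall>n. q dvd V n \<longleftrightarrow> r dvd n"
proof -
  have diff: "q dvd V m" if "q dvd V n" "q dvd V (m + n)" for m n
  proof -
    have "q dvd V (m + n) - U m * V n" using that by simp
    then have "q dvd V m * U n" using pell_add[of D u v m n] by simp
    moreover have "coprime q (U n)"
      using coprime_U_V[of n] that(1) by (meson coprime_commute coprime_divisors dvd_refl)
    ultimately show ?thesis by (simp add: coprime_dvd_mult_left_iff)
  qed
  have mult: "q dvd V (k * n)" if "q dvd V n" for k n
    by (induction k) (use that in \<open>simp_all add: pell_0 pell_add add.commute[of n]\<close>)
  show ?thesis
  proof (cases "\<exists>n>0. q dvd V n")
    case False
    then show ?thesis by (intro exI[of _ 0]) (auto simp: pell_0)
  next
    case True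
    define r where "r = (LEAST n. n > 0 \<and> q dvd V n)"
    have r: "r > 0" "q dvd V r"
      using LeastI_ex[OF True] by (simp_all add: r_def)
    have "r dvd n" if "q dvd V n" for n
    proof -
      have "q dvd V (n mod r + (n div r) * r)" using that by simp
      then have "q dvd V (n mod r)" using diff mult[OF r(2)] by blast
      moreover have "n mod r < r" using r by simp
      ultimately have "n mod r = 0"
        using not_less_Least[of "n mod r" "\<lambda>n. n > 0 \<and> q dvd V n"] unfolding r_def by auto
      then show ?thesis by auto
    qed
    moreover have "q dvd V n" if "r dvd n" for n
      using that mult[OF r(2)] by (metis dvd_def mult.commute)
    ultimately show ?thesis by blast
  qed
qed

private definition rank :: "rat poly \<Rightarrow> nat" where
  "rank q = (SOME r. \<forall>n. q dvd V n \<longleftrightarrow> r dvd n)"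

private lemma rank: "q dvd V n \<longleftrightarrow> rank q dvd n"
  using someI_ex[OF rank_exists[of q]] unfolding rank_def by blast

private lemma rank_set:
  assumes "prime p" "n \<ge> 1"
  shows "{k. k \<ge> 1 \<and> rank (p ^ k) dvd n} = {1..multiplicity p (V n)}"
  using assms V_nz[of n]
  by (auto simp: rank[symmetric] power_dvd_iff_le_multiplicity)

private abbreviation "W \<equiv> pell_v_new D u v"

private lemma new_aux:
  assumes "n \<ge> 1"
  shows "W n \<noteq> 0 \<and> V n = (\<Prod>m | m dvd n. W m) \<and>
    (\<forall>p. prime p \<longrightarrow> multiplicity p (W n) = card {k. k \<ge> 1 \<and> rank (p ^ k) = n})"
  using assms
proof (induction n rule: less_induct)
  case (less n)
  let ?A = "{m. m dvd n \<and> m < n}"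
  let ?Q = "\<Prod>m\<in>?A. W m"
  have fin: "finite ?A" by simp
  have ins: "{m. m dvd n} = insert n ?A"
    using less.prems dvd_imp_le[of _ n] by (auto intro: le_neq_implies_less)
  have A1: "m \<ge> 1" if "m \<in> ?A" for m
    using that by (cases m) auto
  have nz: "W m \<noteq> 0" if "m \<in> ?A" for m
    using less.IH[of m] A1[of m] that by auto
  have Q: "?Q \<noteq> 0" using nz fin by simp
  have mult: "multiplicity p ?Q + card {k. k \<ge> 1 \<and> rank (p ^ k) = n} = multiplicity p (V n)"
    if p: "prime p" for p
  proof -
    let ?K = "\<lambda>m. {k. k \<ge> 1 \<and> rank (p ^ k) = m}"
    have finK: "finite (?K m)" if "m dvd n" for m
    proof (rule finite_subset)
      show "?K m \<subseteq> {k. k \<ge> 1 \<and> rank (p ^ k) dvd n}" using that by auto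
      show "finite {k. k \<ge> 1 \<and> rank (p ^ k) dvd n}"
        unfolding rank_set[OF p less.prems] by simp
    qed
    have "multiplicity p ?Q = (\<Sum>m\<in>?A. multiplicity p (W m))"
      using nz fin p by (intro prime_elem_multiplicity_prod_distrib) auto
    also have "\<dots> = (\<Sum>m\<in>?A. card (?K m))"
      using less.IH A1 p by (intro sum.cong) auto
    also have "\<dots> = card (\<Union>m\<in>?A. ?K m)"
      using fin finK by (intro card_UN_disjoint[symmetric]) auto
    finally have "multiplicity p ?Q + card (?K n) = card (\<Union>m\<in>?A. ?K m) + card (?K n)" by simp
    also have "\<dots> = card ((\<Union>m\<in>?A. ?K m) \<union> ?K n)"
      using fin finK by (intro card_Un_disjoint[symmetric]) auto
    also have "(\<Union>m\<in>?A. ?K m) \<union> ?K n = {k. k \<ge> 1 \<and> rank (p ^ k) dvd n}"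
    proof (intro equalityI subsetI)
      fix k assume "k \<in> {k. k \<ge> 1 \<and> rank (p ^ k) dvd n}"
      then have "k \<ge> 1" "rank (p ^ k) \<in> insert n ?A"
        using ins by auto
      then show "k \<in> (\<Union>m\<in>?A. ?K m) \<union> ?K n" by auto
    qed auto
    also have "card \<dots> = multiplicity p (V n)"
      unfolding rank_set[OF p less.prems] by simp
    finally show ?thesis .
  qed
  have "?Q dvd V n"
    using Q mult by (intro multiplicity_le_imp_dvd) (metis le_add1)+
  then have eq: "V n = W n * ?Q"
    using Q by (subst pell_v_new.simps) simp
  then have W: "W n \<noteq> 0" using V_nz[OF less.prems] by auto
  have "V n = (\<Prod>m | m dvd n. W m)"
    unfolding ins using eq fin by simp
  moreover have "multiplicity p (W n) = card {k. k \<ge> 1 \<and> rank (p ^ k) = n}" if p: "prime p" for p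
  proof -
    have "multiplicity p (V n) = multiplicity p (W n) + multiplicity p ?Q"
      unfolding eq using W Q p by (intro prime_elem_multiplicity_mult_distrib) auto
    then show ?thesis using mult[OF p] by simp
  qed
  ultimately show ?case using W by blast
qed

lemma pell_v_eq_prod_new:
  assumes "n \<ge> 1"
  shows "pell_v D u v n = (\<Prod>m | m dvd n. pell_v_new D u v m)"
  using new_aux[OF assms] by blast

lemma pell_v_new_unique:
  assumes w: "\<And>n. n \<ge> 1 \<Longrightarrow> pell_v D u v n = (\<Prod>m | m dvd n. w m)" and "n \<ge> 1"
  shows "w n = pell_v_new D u v n"
  using \<open>n \<ge> 1\<close>
proof (induction n rule: less_induct)
  case (less n)
  let ?A = "{m. m dvd n \<and> m < n}"
  have ins: "{m. m dvd n} = insert n ?A"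
    using less.prems dvd_imp_le[of _ n] by (auto intro: le_neq_implies_less)
  have A1: "m \<ge> 1" if "m \<in> ?A" for m
    using that by (cases m) auto
  have "w m = W m" if "m \<in> ?A" for m
    using less.IH[of m] A1[of m] that by blast
  then have "(\<Prod>m\<in>?A. w m) = (\<Prod>m\<in>?A. W m)" by (rule prod.cong[OF refl])
  moreover have "w n * (\<Prod>m\<in>?A. w m) = W n * (\<Prod>m\<in>?A. W m)"
    using w[OF less.prems] pell_v_eq_prod_new[OF less.prems] by (simp add: ins)
  moreover have "(\<Prod>m\<in>?A. W m) \<noteq> 0"
    using new_aux A1 by auto
  ultimately show ?case by simp
qed

end

end

theory Submission
  imports Defs "HOL-Number_Theory.Totient" "HOL-Analysis.Infinite_Products"
begin

text \<open>
  Let \<open>a\<close> be a complex root of an element \<open>P\<close> of \<open>I(N)\<close>. Then \<open>v\<^sub>m(a) = 0\<close> for some \<open>m \<ge> 1\<close>, so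
  \<open>z = u(a) + v(a) * sqrt (D(a))\<close> satisfies \<open>z ^ m = z ^ (-m)\<close>: it is a primitive \<open>n\<close>-th root of unity
  for some \<open>n\<close>, and \<open>u(a) = (z + 1 / z) / 2\<close>. The latter number has \<open>\<phi>(n) / 2\<close> or more conjugates
  because the cyclotomic polynomials are irreducible, whence \<open>\<phi>(n) \<le> 2 * deg P \<le> 2 * N\<close>. If \<open>c\<close> is its
  minimal polynomial, all \<open>P\<close> with the same \<open>n\<close> divide \<open>c(u(t))\<close> and have degree at least \<open>deg c\<close>, so there
  are at most \<open>deg u\<close> of them. It remains to see that \<open>\<phi>(n) \<le> 2 * N\<close> has fewer than \<open>10 * N\<close> solutions;
  this follows from the second moment of \<open>n / \<phi>(n)\<close>, applied to \<open>n > 4 * N\<close>.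
\<close>

text \<open>In \<open>Field_as_Ring\<close> these rules apply to \<open>/\<close> on fields, where they loop with \<open>field_simps\<close>.\<close>

declare div_mult_self1 [simp del] div_mult_self2 [simp del] div_mult_self3 [simp del]
  div_mult_self4 [simp del]

subsection \<open>Counting the solutions of \<open>\<phi>(n) \<le> x\<close>\<close>

text \<open>Chosen so that \<open>1 + totient_weight p\<close> is \<open>(p / (p - 1))^2\<close>,
  the Euler factor of \<open>(n / phi(n))^2\<close> at \<open>p\<close>.\<close>

definition totient_weight :: "nat \<Rightarrow> real" where
  "totient_weight p = (2 * real p - 1) / (real p - 1)\<^sup>2"

lemma totient_weight_nonneg: "p \<ge> 2 \<Longrightarrow> totient_weight p \<ge> 0"
  by (simp add: totient_weight_def)

lemma square_ratio_totient:
  assumes "n > 0"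
  shows "(real n / real (totient n))\<^sup>2 = (\<Prod>p\<in>prime_factors n. 1 + totient_weight p)"
proof -
  have "real n / real (totient n) = (\<Prod>p\<in>prime_factors n. 1 / (1 - 1 / real p))"
    using assms by (simp add: totient_formula2 prod_dividef)
  moreover have "(1 / (1 - 1 / real p))\<^sup>2 = 1 + totient_weight p" if "p \<in> prime_factors n" for p
  proof -
    have "p \<ge> 2" using that prime_ge_2_nat by blast
    then have "real p > 1" by simp
    then have "1 / (1 - 1 / real p) = real p / (real p - 1)" by (simp add: field_simps)
    also have "\<dots>\<^sup>2 = 1 + totient_weight p"
      using \<open>real p > 1\<close> unfolding totient_weight_def
      by (simp add: power_divide add_divide_eq_iff) (simp add: power2_eq_square algebra_simps)
    finally show ?thesis .
  qed
  ultimately show ?thesis by (simp add: prod_power_distrib)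
qed

text \<open>Telescoping: \<open>1 / m^2\<close> is at most
  \<open>1 / (m^2 - 1/4) = 1 / (m - 1/2) - 1 / (m + 1/2)\<close>. The half-integer shift also keeps
  the bound finite at \<open>M = 0\<close>.\<close>

lemma sum_inverse_squares_le:
  "M \<le> X \<Longrightarrow> (\<Sum>m\<in>{M<..X}. 1 / (real m)\<^sup>2) \<le> 1 / (real M + 1/2) - 1 / (real X + 1/2)"
proof (induction X)
  case 0
  then show ?case by simp
next
  case (Suc X)
  show ?case
  proof (cases "M = Suc X")
    case False
    then have "M \<le> X" using Suc.prems by simp
    then have "{M<..Suc X} = insert (Suc X) {M<..X}" by auto
    then have "(\<Sum>m\<in>{M<..Suc X}. 1 / (real m)\<^sup>2)
        \<le> 1 / (real X + 1)\<^sup>2 + (1 / (real M + 1/2) - 1 / (real X + 1/2))"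
      using Suc.IH[OF \<open>M \<le> X\<close>] by (simp add: add.commute)
    moreover have "1 / (real X + 1)\<^sup>2 \<le> 1 / (real X + 1/2) - 1 / (real X + 3/2)"
      by (simp add: divide_simps power2_eq_square) (simp add: algebra_simps)
    moreover have eq: "real (Suc X) + 1/2 = real X + 3/2" by simp
    ultimately show ?thesis unfolding eq by linarith
  qed simp
qed

text \<open>Replaces the integer part \<open>M\<close> of \<open>z\<close> by \<open>z\<close>
  itself while keeping the coefficient 1 of the main term. The error exponent 3/2 is a compromise:
  with \<open>z = T / d\<close> it leaves a factor \<open>1 / sqrt d\<close> in the sum over
  multiples of \<open>d\<close>, which keeps the later product over primes bounded.\<close>

lemma inverse_half_integer_le:
  fixes z :: real
  assumes "z > 0" "z < real M + 1" "real M \<le> z"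
  shows "1 / (real M + 1/2) \<le> 1 / z + 1 / (z * sqrt z)"
proof (cases "M = 0")
  case True
  then have "z < 1" using assms by simp
  then have "sqrt z \<le> 1" using real_sqrt_le_1_iff less_imp_le by blast
  then have "z * sqrt z \<le> 1" using assms(1) \<open>z < 1\<close> by (simp add: mult_le_one)
  then have "1 / z \<ge> 1" "1 / (z * sqrt z) \<ge> 1" using assms(1) \<open>z < 1\<close> by auto
  then show ?thesis using True by simp
next
  case False
  then have "z \<ge> 1" using assms by linarith
  define w where "w = sqrt z"
  have w: "w \<ge> 1" "z = w\<^sup>2" using \<open>z \<ge> 1\<close> by (simp_all add: w_def)
  have "w ^ 3 \<le> (w + 1) * (w\<^sup>2 - 1/2)"
  proof -
    have "(w + 1) * (w\<^sup>2 - 1/2) - w ^ 3 = (w - 1) * (w + 1/2)"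
      by (simp add: field_simps power2_eq_square power3_eq_cube)
    moreover have "(w - 1) * (w + 1/2) \<ge> 0" using w by simp
    ultimately show ?thesis by linarith
  qed
  also have "\<dots> \<le> (w + 1) * (real M + 1/2)"
    using w assms by (intro mult_left_mono) auto
  finally have "1 / (real M + 1/2) \<le> (w + 1) / w ^ 3"
    using w by (simp add: divide_simps mult.commute)
  also have "\<dots> = 1 / z + 1 / (z * sqrt z)"
    using w by (simp add: field_simps power2_eq_square power3_eq_cube flip: w_def)
  finally show ?thesis .
qed

text \<open>Writing \<open>n = d * m\<close> turns the sum into a tail over
  \<open>m > T div d\<close>; the rounding of \<open>T / d\<close> costs the second summand.\<close>

lemma sum_inverse_squares_multiples_le:
  assumes "d > 0" "T > 0"
  shows "(\<Sum>n | n \<in> {T<..X} \<and> d dvd n. 1 / (real n)\<^sup>2)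
    \<le> 1 / (real d * real T) + 1 / (sqrt d * (real T * sqrt T))"
proof -
  let ?M = "T div d"
  define z where "z = real T / real d"
  have "real T = real d * real ?M + real (T mod d)"
    by (metis mult_div_mod_eq of_nat_add of_nat_mult)
  moreover have "real (T mod d) < real d" using assms by simp
  ultimately have z: "z > 0" "z < real ?M + 1" "real ?M \<le> z"
    using assms by (simp_all add: z_def field_simps)
  have "{n. n \<in> {T<..X} \<and> d dvd n} \<subseteq> (*) d ` {?M<..X}"
  proof
    fix n assume n: "n \<in> {n. n \<in> {T<..X} \<and> d dvd n}"
    then obtain m where m: "n = d * m" by auto
    have "m \<le> d * m" "d * m \<le> X" using assms n m by simp_all
    then have "m \<le> X" by linarith
    moreover have "?M < m" using n m assms by (simp add: div_less_iff_less_mult mult.commute)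
    ultimately show "n \<in> (*) d ` {?M<..X}" using m by auto
  qed
  then have "(\<Sum>n | n \<in> {T<..X} \<and> d dvd n. 1 / (real n)\<^sup>2) \<le> (\<Sum>n\<in>(*) d ` {?M<..X}. 1 / (real n)\<^sup>2)"
    by (intro sum_mono2) auto
  also have "\<dots> = (\<Sum>m\<in>{?M<..X}. 1 / (real (d * m))\<^sup>2)"
    using assms by (subst sum.reindex) (auto simp: inj_on_def)
  also have "\<dots> = 1 / (real d)\<^sup>2 * (\<Sum>m\<in>{?M<..X}. 1 / (real m)\<^sup>2)"
    by (simp add: sum_distrib_left power_mult_distrib)
  also have "\<dots> \<le> 1 / (real d)\<^sup>2 * (1 / z + 1 / (z * sqrt z))"
  proof (intro mult_left_mono)
    show "(\<Sum>m\<in>{?M<..X}. 1 / (real m)\<^sup>2) \<le> 1 / z + 1 / (z * sqrt z)"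
    proof (cases "?M \<le> X")
      case True
      have "(\<Sum>m\<in>{?M<..X}. 1 / (real m)\<^sup>2) \<le> 1 / (real ?M + 1/2)"
        using sum_inverse_squares_le[OF True]
        by (smt (verit) of_nat_0_le_iff zero_le_divide_iff)
      also have "\<dots> \<le> 1 / z + 1 / (z * sqrt z)" by (intro inverse_half_integer_le z)
      finally show ?thesis .
    next
      case False
      then show ?thesis using z(1) by simp
    qed
  qed simp
  also have "\<dots> = 1 / (real d * real T) + 1 / (sqrt d * (real T * sqrt T))"
  proof -
    define a b where "a = sqrt d" and "b = sqrt T"
    have "sqrt z = b / a" by (simp add: a_def b_def z_def real_sqrt_divide)
    moreover have "real d = a * a" "real T = b * b" "a > 0" "b > 0"
      using assms by (simp_all add: a_def b_def)
    ultimately show ?thesis unfolding a_def[symmetric] b_def[symmetric] z_def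
      by (simp add: field_simps power2_eq_square)
  qed
  finally show ?thesis .
qed

text \<open>Expanding \<open>(n / \<phi>(n))\<^sup>2 = (\<Prod>p | p dvd n. 1 + totient_weight p)\<close> over the sets of prime divisors of \<open>n\<close> and
  summing over the multiples of each squarefree number. The second summand absorbs the rounding
  errors.\<close>

lemma sum_inverse_totient_squares_le:
  fixes T X :: nat
  assumes "T > 0"
  defines "P \<equiv> {p. prime p \<and> p \<le> X}"
  shows "(\<Sum>n\<in>{T<..X}. (1 / real (totient n))\<^sup>2)
    \<le> (\<Prod>p\<in>P. 1 + totient_weight p / p) / T + (\<Prod>p\<in>P. 1 + totient_weight p / sqrt p) / (T * sqrt T)"
proof -
  have finP: "finite P" unfolding P_def by (rule finite_subset[of _ "{..X}"]) auto
  have P2: "p \<ge> 2" if "p \<in> P" for p using that prime_ge_2_nat by (auto simp: P_def)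
  let ?g = "\<lambda>A. \<Prod>p\<in>A. totient_weight p"
  have expand: "(\<Prod>p\<in>B. 1 + f p) = (\<Sum>A\<in>Pow B. \<Prod>p\<in>A. f p)" if "finite B" for B and f :: "nat \<Rightarrow> real"
    using prod_add[OF that, of f "\<lambda>_. 1"] by (simp add: add.commute)
  \<comment> \<open>Since \<open>P\<close> contains every prime up to \<open>X\<close>, the prime
    sets belonging to \<open>n\<close> become a filter on one index set, so that the two sums can be
    interchanged.\<close>
  have subsets: "Pow (prime_factors n) = {A \<in> Pow P. \<Prod>A dvd n}" if "n \<in> {T<..X}" for n
  proof (intro equalityI subsetI)
    fix A assume A: "A \<in> Pow (prime_factors n)"
    have "p dvd n \<Longrightarrow> p \<le> X" for p using that by (auto dest: dvd_imp_le)
    then have "A \<subseteq> P" using A by (auto simp: P_def)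
    moreover have "\<Prod>A dvd n"
    proof -
      have "\<Prod>A dvd \<Prod>(prime_factors n)" using A by (intro prod_dvd_prod_subset) auto
      also have "\<dots> dvd (\<Prod>p\<in>prime_factors n. p ^ multiplicity p n)"
        by (intro prod_dvd_prod) (auto simp: prime_factors_multiplicity intro: dvd_power)
      also have "\<dots> = n" using that by (intro prime_factorization_nat[symmetric]) auto
      finally show ?thesis .
    qed
    ultimately show "A \<in> {A \<in> Pow P. \<Prod>A dvd n}" by auto
  next
    fix A assume A: "A \<in> {A \<in> Pow P. \<Prod>A dvd n}"
    then have "finite A" using finP finite_subset by auto
    then have "p dvd n" if "p \<in> A" for p
      using dvd_prodI[OF \<open>finite A\<close> that, of "\<lambda>p. p"] A by (auto intro: dvd_trans)
    moreover have "prime p" if "p \<in> A" for p using A that by (auto simp: P_def)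
    moreover have "n \<noteq> 0" using that by simp
    ultimately show "A \<in> Pow (prime_factors n)"
      by (meson PowI prime_factorsI subsetI)
  qed
  have "(\<Sum>n\<in>{T<..X}. (1 / real (totient n))\<^sup>2)
      = (\<Sum>n\<in>{T<..X}. (\<Sum>A\<in>Pow P. if \<Prod>A dvd n then ?g A * (1 / (real n)\<^sup>2) else 0))"
  proof (intro sum.cong refl)
    fix n assume n: "n \<in> {T<..X}"
    have "(1 / real (totient n))\<^sup>2 = (real n / real (totient n))\<^sup>2 * (1 / (real n)\<^sup>2)"
      using n by (simp add: power_divide)
    also have "(real n / real (totient n))\<^sup>2 = (\<Sum>A\<in>{A \<in> Pow P. \<Prod>A dvd n}. ?g A)"
      unfolding subsets[OF n, symmetric]
      using n by (subst square_ratio_totient) (simp_all add: expand)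
    finally show "(1 / real (totient n))\<^sup>2 = (\<Sum>A\<in>Pow P. if \<Prod>A dvd n then ?g A * (1 / (real n)\<^sup>2) else 0)"
      using finP by (simp add: sum_distrib_right sum_divide_distrib sum.inter_filter[symmetric])
  qed
  also have "\<dots> = (\<Sum>A\<in>Pow P. ?g A * (\<Sum>n | n \<in> {T<..X} \<and> \<Prod>A dvd n. 1 / (real n)\<^sup>2))"
    by (subst sum.swap, intro sum.cong refl)
      (simp add: sum_distrib_left sum.inter_filter[symmetric] del: greaterThanAtMost_iff)
  also have "\<dots> \<le> (\<Sum>A\<in>Pow P. ?g A * (1 / (real (\<Prod>A) * T) + 1 / (sqrt (\<Prod>A) * (T * sqrt T))))"
  proof (intro sum_mono mult_left_mono sum_inverse_squares_multiples_le assms)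
    fix A assume A: "A \<in> Pow P"
    show "\<Prod>A > 0" using A P2 by (intro prod_pos) fastforce
    show "?g A \<ge> 0" using A P2 by (intro prod_nonneg totient_weight_nonneg) auto
  qed
  also have "\<dots> = (\<Sum>A\<in>Pow P. (\<Prod>p\<in>A. totient_weight p / p) / T + (\<Prod>p\<in>A. totient_weight p / sqrt p) / (T * sqrt T))"
  proof (intro sum.cong refl)
    fix A
    have "sqrt (real (\<Prod>A)) = (\<Prod>p\<in>A. sqrt p)"
      by (induction A rule: infinite_finite_induct) (simp_all add: real_sqrt_mult)
    then show "?g A * (1 / (real (\<Prod>A) * T) + 1 / (sqrt (\<Prod>A) * (T * sqrt T)))
      = (\<Prod>p\<in>A. totient_weight p / p) / T + (\<Prod>p\<in>A. totient_weight p / sqrt p) / (T * sqrt T)"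
      by (simp add: prod_dividef distrib_left)
  qed
  finally show ?thesis
    by (simp add: expand[OF finP] sum.distrib sum_divide_distrib)
qed

text \<open>The square of each factor is at most \<open>k\<^sup>2 / ((k - 1) * (k + 1))\<close>, and that product telescopes.\<close>

lemma prod_inverse_square_odd_le:
  "(\<Prod>k\<in>{2..Suc K}. 1 + 1 / (2 * (real k)\<^sup>2)) ^ 2 \<le> 2 * (real K + 1) / (real K + 2)"
proof (induction K)
  case 0
  then show ?case by simp
next
  case (Suc K)
  define k where "k = real K + 2"
  have k: "k \<ge> 2" by (simp add: k_def)
  have step: "(1 + 1 / (2 * k\<^sup>2)) ^ 2 \<le> k\<^sup>2 / ((k - 1) * (k + 1))"
  proof -
    define s where "s = k\<^sup>2"
    have s: "s \<ge> 4" using k power_mono[of 2 k 2] by (simp add: s_def)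
    have "(1 + 1 / (2 * s)) ^ 2 \<le> s / (s - 1)"
    proof -
      have "(2 * s + 1)\<^sup>2 * (s - 1) \<le> s * (2 * s)\<^sup>2"
        using s by (simp add: power2_eq_square algebra_simps)
      then have "(2 * s + 1)\<^sup>2 / (2 * s)\<^sup>2 \<le> s / (s - 1)"
        using s by (simp add: divide_simps)
      moreover have "1 + 1 / (2 * s) = (2 * s + 1) / (2 * s)" using s by (simp add: field_simps)
      ultimately show ?thesis by (simp add: power_divide)
    qed
    moreover have "(k - 1) * (k + 1) = s - 1" by (simp add: s_def power2_eq_square algebra_simps)
    ultimately show ?thesis by (simp add: s_def)
  qed
  have "(\<Prod>k\<in>{2..Suc (Suc K)}. 1 + 1 / (2 * (real k)\<^sup>2)) ^ 2
      = (\<Prod>k\<in>{2..Suc K}. 1 + 1 / (2 * (real k)\<^sup>2)) ^ 2 * (1 + 1 / (2 * k\<^sup>2)) ^ 2"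
    by (simp add: power_mult_distrib k_def add.commute)
  also have "\<dots> \<le> (2 * (k - 1) / k) * (k\<^sup>2 / ((k - 1) * (k + 1)))"
    using Suc step k by (intro mult_mono) (simp_all add: k_def add.commute)
  also have "\<dots> = 2 * k / (k + 1)"
    using k by (simp add: divide_simps power2_eq_square)
  finally show ?case by (simp add: k_def add.commute)
qed

text \<open>The primes 2 and 3 contribute at most the exact factors 5/2 and 17/12. The others are
  among the odd numbers \<open>2 * k + 1\<close> with \<open>k >= 2\<close>, whose factors are at
  most \<open>1 + 1 / (2 * k^2)\<close>; their product is below
  \<open>sqrt 2 < 1.42\<close>.\<close>

lemma prod_totient_weight_le:
  assumes "finite P" "\<And>p. p \<in> P \<Longrightarrow> prime p"
  shows "(\<Prod>p\<in>P. 1 + totient_weight p / p) \<le> 51 / 10"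
proof -
  let ?f = "\<lambda>p::nat. 1 + totient_weight p / p"
  define X where "X = Max (insert 1 P)"
  have X: "p \<le> X" if "p \<in> P" for p using that assms(1) by (auto simp: X_def)
  let ?O = "(\<lambda>k. 2 * k + 1) ` {2..Suc X}"
  let ?R = "\<Prod>k\<in>{2..Suc X}. 1 + 1 / (2 * (real k)\<^sup>2)"
  have P2: "p \<ge> 2" if "p \<in> P" for p using that assms(2) prime_ge_2_nat by blast
  have f1: "?f p \<ge> 1" if "p \<ge> 2" for p using totient_weight_nonneg[OF that] by simp
  have sub: "P \<subseteq> insert 2 (insert 3 ?O)"
  proof
    fix p assume p: "p \<in> P"
    show "p \<in> insert 2 (insert 3 ?O)"
    proof (cases "p = 2 \<or> p = 3")
      case False
      then have "odd p" using assms(2)[OF p] primes_dvd_imp_eq[of 2 p] by auto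
      with False have "p \<ge> 5" using P2[OF p] by presburger
      obtain k where "p = 2 * k + 1" using \<open>odd p\<close> by (auto elim: oddE)
      moreover have "k \<in> {2..Suc X}" using X[OF p] \<open>p \<ge> 5\<close> calculation by auto
      ultimately show ?thesis by auto
    qed auto
  qed
  have "(\<Prod>p\<in>P. ?f p) \<le> (\<Prod>p\<in>insert 2 (insert 3 ?O). ?f p)"
  proof (intro prod_mono2 sub)
    show "1 \<le> ?f p" if "p \<in> insert 2 (insert 3 ?O) - P" for p using that by (intro f1) auto
    show "0 \<le> ?f p" if "p \<in> P" for p using f1[OF P2[OF that]] by linarith
  qed auto
  also have "\<dots> = (5/2) * (17/12) * (\<Prod>p\<in>?O. ?f p)"
    by (simp add: totient_weight_def image_iff)
  also have "(\<Prod>p\<in>?O. ?f p) = (\<Prod>k\<in>{2..Suc X}. ?f (2 * k + 1))"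
    by (subst prod.reindex) (auto simp: inj_on_def)
  also have "\<dots> \<le> ?R"
  proof (intro prod_mono conjI)
    fix k assume k: "k \<in> {2..Suc X}"
    then have "real k \<ge> 2" by simp
    then show "?f (2 * k + 1) \<le> 1 + 1 / (2 * (real k)\<^sup>2)"
      by (simp add: totient_weight_def divide_simps power2_eq_square) (simp add: algebra_simps)
    show "0 \<le> ?f (2 * k + 1)" using k by (intro order.trans[OF zero_le_one f1]) auto
  qed
  also have "?R \<le> 1.42"
  proof -
    have "?R ^ 2 \<le> 2 * (real X + 1) / (real X + 2)" by (rule prod_inverse_square_odd_le)
    also have "\<dots> \<le> 1.42 ^ 2" by (simp add: divide_simps power2_eq_square)
    finally show ?thesis by (rule power2_le_imp_le) simp
  qed
  finally show ?thesis by simp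
qed

text \<open>As \<open>1 + x <= exp x\<close> and \<open>totient_weight p <= 8 / p\<close>, the
  logarithm is dominated by the convergent series of \<open>8 * n powr (-3/2)\<close>. The bound
  only enters a term of order \<open>sqrt N\<close>, so any finite value will do.\<close>

lemma prod_totient_weight_sqrt_bounded:
  "\<exists>C. \<forall>P. finite P \<longrightarrow> (\<forall>p\<in>P. prime p) \<longrightarrow> (\<Prod>p\<in>P. 1 + totient_weight p / sqrt p) \<le> C"
proof (intro exI allI impI)
  fix P :: "nat set" assume P: "finite P" "\<forall>p\<in>P. prime p"
  let ?h = "\<lambda>n::nat. 8 * real n powr (-3/2)"
  have sum: "summable ?h"
    by (intro summable_mult) (simp add: summable_real_powr_iff)
  have P2: "real p \<ge> 2" if "p \<in> P" for p
    using that P prime_ge_2_nat by (metis of_nat_le_iff of_nat_numeral)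
  have bound: "0 \<le> totient_weight p / sqrt p \<and> totient_weight p / sqrt p \<le> ?h p" if "p \<in> P" for p
  proof -
    have p: "real p \<ge> 2" using P2[OF that] .
    have "(2 * real p - 1) * real p \<le> 8 * (real p - 1)\<^sup>2"
    proof -
      have "real p ^ 2 \<le> (2 * (real p - 1)) ^ 2" using p by (intro power_mono) auto
      then have "2 * real p ^ 2 \<le> 8 * (real p - 1)\<^sup>2" by (simp only: power_mult_distrib) simp
      moreover have "(2 * real p - 1) * real p \<le> 2 * real p ^ 2"
        using p by (simp add: power2_eq_square algebra_simps)
      ultimately show ?thesis by linarith
    qed
    then have "totient_weight p \<le> 8 / p"
      using p by (simp add: totient_weight_def divide_simps mult.commute)
    then have "totient_weight p / sqrt p \<le> 8 / p / sqrt p"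
      by (intro divide_right_mono) auto
    also have "\<dots> = ?h p"
    proof -
      have "real p powr (3/2) = real p powr (1 + 1/2)" by simp
      also have "\<dots> = real p * sqrt p" using p by (simp only: powr_add powr_half_sqrt) simp
      finally have "real p powr (3/2) = real p * sqrt p" .
      moreover have "real p powr (-3/2) = 1 / real p powr (3/2)"
        using powr_minus_divide[of "real p" "3/2"] by simp
      ultimately show ?thesis by simp
    qed
    finally show ?thesis using p by (simp add: totient_weight_def)
  qed
  have "(\<Prod>p\<in>P. 1 + totient_weight p / sqrt p) \<le> exp (\<Sum>p\<in>P. totient_weight p / sqrt p)"
    using bound by (intro prod_le_exp_sum) auto
  also have "\<dots> \<le> exp (\<Sum>p\<in>P. ?h p)"
    using bound by (simp add: sum_mono)
  also have "\<dots> \<le> exp (\<Sum>n. ?h n)"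
    using sum_le_suminf[OF sum P(1)] by simp
  finally show "(\<Prod>p\<in>P. 1 + totient_weight p / sqrt p) \<le> exp (\<Sum>n. ?h n)" .
qed

text \<open>A Chebyshev-type estimate: every \<open>n > T\<close> with
  \<open>phi(n) <= 2 * N\<close> contributes at least 1 to the sum of
  \<open>(2 * N / phi(n))^2\<close>. The second moment then gives \<open>4 * N + 51/10 * N\<close>
  up to a multiple of \<open>sqrt N\<close>.\<close>

lemma card_totient_le:
  obtains K where "\<And>N. N > 0 \<Longrightarrow> finite {n. n > 0 \<and> totient n \<le> 2 * N}"
    "\<And>N. N > 0 \<Longrightarrow> card {n. n > 0 \<and> totient n \<le> 2 * N} \<le> 91 / 10 * real N + K * sqrt N"
proof -
  obtain C where C: "\<And>P. finite P \<Longrightarrow> \<forall>p\<in>P. prime p \<Longrightarrow>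
      (\<Prod>p\<in>P. 1 + totient_weight p / sqrt p) \<le> C"
    using prod_totient_weight_sqrt_bounded by blast
  have C0: "C \<ge> 0" using C[of "{}"] by simp
  \<comment> \<open>Finite subsets are bounded first; the uniform bound on them then yields
    finiteness of the whole set.\<close>
  have bound: "real (card F) \<le> 91 / 10 * real N + C / 2 * sqrt N"
    if N: "N > 0" and F: "F \<subseteq> {n. n > 0 \<and> totient n \<le> 2 * N}" "finite F" for F N
  proof -
    \<comment> \<open>the numbers up to \<open>T\<close> are counted trivially; the choice nearly minimises \<open>T + 4 * N\<^sup>2 * (51 / 10) / T\<close>\<close>
    define T where "T = 4 * N"
    define X where "X = Max (insert 1 F)"
    define P where "P = {p. prime p \<and> p \<le> X}"
    have finP: "finite P" unfolding P_def by (rule finite_subset[of _ "{..X}"]) auto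
    have X: "n \<le> X" if "n \<in> F" for n using that F(2) by (auto simp: X_def)
    have "F \<subseteq> {1..T} \<union> (F \<inter> {T<..X})" using F X by (auto simp: Suc_le_eq)
    then have "card F \<le> card ({1..T} \<union> (F \<inter> {T<..X}))" by (intro card_mono) auto
    also have "\<dots> \<le> T + card (F \<inter> {T<..X})" using card_Un_le[of "{1..T}"] by simp
    finally have 1: "real (card F) \<le> T + real (card (F \<inter> {T<..X}))" by linarith
    have "real (card (F \<inter> {T<..X})) = (\<Sum>n\<in>F \<inter> {T<..X}. 1)" by simp
    also have "\<dots> \<le> (\<Sum>n\<in>F \<inter> {T<..X}. (2 * real N)\<^sup>2 * (1 / real (totient n))\<^sup>2)"
    proof (intro sum_mono)
      fix n assume "n \<in> F \<inter> {T<..X}"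
      then have "totient n \<le> 2 * N" "totient n > 0" using F by auto
      then have "real (totient n) > 0" "real (totient n) \<le> 2 * real N" by linarith+
      then have "1 \<le> 2 * real N * (1 / real (totient n))" by simp
      from power_mono[OF this, of 2] show "1 \<le> (2 * real N)\<^sup>2 * (1 / real (totient n))\<^sup>2"
        by (simp add: power_mult_distrib power_divide)
    qed
    also have "\<dots> \<le> (\<Sum>n\<in>{T<..X}. (2 * real N)\<^sup>2 * (1 / real (totient n))\<^sup>2)"
      by (intro sum_mono2) auto
    also have "\<dots> = (2 * real N)\<^sup>2 * (\<Sum>n\<in>{T<..X}. (1 / real (totient n))\<^sup>2)"
      by (simp add: sum_distrib_left)
    also have "\<dots> \<le> (2 * real N)\<^sup>2 * ((51 / 10) / T + C / (T * sqrt T))"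
    proof (intro mult_left_mono order.trans[OF sum_inverse_totient_squares_le] add_mono divide_right_mono)
      show "T > 0" using N by (simp add: T_def)
      show "(\<Prod>p\<in>{p. prime p \<and> p \<le> X}. 1 + totient_weight p / p) \<le> 51 / 10"
        unfolding P_def[symmetric] by (rule prod_totient_weight_le[OF finP]) (auto simp: P_def)
      show "(\<Prod>p\<in>{p. prime p \<and> p \<le> X}. 1 + totient_weight p / sqrt p) \<le> C"
        unfolding P_def[symmetric] by (rule C[OF finP]) (auto simp: P_def)
    qed auto
    also have "\<dots> = (51 / 10) * N + C / 2 * sqrt N"
    proof -
      have "sqrt (real T) = 2 * sqrt N" by (simp add: T_def real_sqrt_mult)
      then have "T * sqrt T = 8 * (real N * sqrt N)" "real T = 4 * real N"
        by (simp_all add: T_def)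
      moreover have "(2 * real N)\<^sup>2 * (C / (8 * (real N * sqrt N))) = C / 2 * (real N / sqrt N)"
        using N by (simp add: field_simps power2_eq_square)
      moreover have "real N / sqrt N = sqrt N" by (rule real_div_sqrt) simp
      ultimately show ?thesis
        using N by (simp add: distrib_left) (simp add: field_simps power2_eq_square)
    qed
    finally show ?thesis using 1 by (simp add: T_def)
  qed
  have fc: "finite {n. n > 0 \<and> totient n \<le> 2 * N} \<and>
      card {n. n > 0 \<and> totient n \<le> 2 * N} \<le> nat \<lfloor>91 / 10 * real N + C / 2 * sqrt N\<rfloor>"
    if "N > 0" for N
    using bound[OF that] by (intro finite_if_finite_subsets_card_bdd) (simp add: le_nat_floor)
  show thesis
  proof (rule that)
    fix N :: nat assume N: "N > 0"
    show "finite {n. n > 0 \<and> totient n \<le> 2 * N}" using fc[OF N] by simp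
    then show "card {n. n > 0 \<and> totient n \<le> 2 * N} \<le> 91 / 10 * real N + C / 2 * sqrt N"
      using bound[OF N] by blast
  qed
qed

subsection \<open>Conjugates of roots of unity\<close>

definition rat_eval :: "rat poly \<Rightarrow> complex \<Rightarrow> complex" where
  "rat_eval q z = poly (map_poly of_rat q) z"

lemma rat_eval_pCons [simp]: "rat_eval (pCons a q) z = of_rat a + z * rat_eval q z"
  by (simp add: rat_eval_def map_poly_pCons)

lemma rat_eval_0 [simp]: "rat_eval 0 z = 0"
  by (simp add: rat_eval_def)

lemma rat_eval_1 [simp]: "rat_eval 1 z = 1"
  by (simp add: rat_eval_def)

lemma rat_eval_add [simp]: "rat_eval (p + q) z = rat_eval p z + rat_eval q z"
proof (induction p arbitrary: q)
  case step: (pCons a p)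
  show ?case
  proof (cases q)
    case (pCons b r)
    then show ?thesis using step.IH[of r] by (simp add: algebra_simps of_rat_add)
  qed
qed simp

lemma rat_eval_smult [simp]: "rat_eval (smult c p) z = of_rat c * rat_eval p z"
  by (induction p) (simp_all add: of_rat_mult algebra_simps)

lemma rat_eval_minus [simp]: "rat_eval (- p) z = - rat_eval p z"
  using rat_eval_smult[of "-1" p z] by (simp add: of_rat_minus)

lemma rat_eval_diff [simp]: "rat_eval (p - q) z = rat_eval p z - rat_eval q z"
  using rat_eval_add[of p "- q" z] by simp

lemma rat_eval_mult [simp]: "rat_eval (p * q) z = rat_eval p z * rat_eval q z"
  by (induction p) (simp_all add: algebra_simps)

lemma rat_eval_power [simp]: "rat_eval (p ^ n) z = rat_eval p z ^ n"
  by (induction n) simp_all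

lemma rat_eval_pcompose [simp]: "rat_eval (pcompose p q) z = rat_eval p (rat_eval q z)"
  by (induction p) (simp_all add: pcompose_pCons)

lemma rat_eval_monom [simp]: "rat_eval (monom c n) z = of_rat c * z ^ n"
  by (simp add: rat_eval_def map_poly_monom poly_monom)

lemma rat_eval_dvd: "p dvd q \<Longrightarrow> rat_eval p z = 0 \<Longrightarrow> rat_eval q z = 0"
  by (auto elim!: dvdE)

lemma rat_eval_roots:
  assumes "q \<noteq> 0"
  shows "finite {z. rat_eval q z = 0}" "card {z. rat_eval q z = 0} \<le> degree q"
proof -
  have *: "map_poly of_rat q \<noteq> (0 :: complex poly)"
    using assms by (simp add: map_poly_eq_0_iff)
  show "finite {z. rat_eval q z = 0}"
    unfolding rat_eval_def by (rule poly_roots_finite[OF *])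
  show "card {z. rat_eval q z = 0} \<le> degree q"
    using card_poly_roots_bound[OF *] by (simp add: rat_eval_def degree_map_poly)
qed

lemma rat_eval_root_exists:
  assumes "degree q > 0"
  obtains z where "rat_eval q z = 0"
proof -
  have "\<not> constant (poly (map_poly of_rat q :: complex poly))"
    using assms by (simp add: constant_degree degree_map_poly)
  then show ?thesis
    using that fundamental_theorem_of_algebra by (auto simp: rat_eval_def)
qed

text \<open>Take \<open>f\<close> nonzero of least degree vanishing at \<open>z\<close>: if
  \<open>p\<close> vanishes there, so does its remainder modulo \<open>f\<close>, which must then be
  0.\<close>

lemma minimal_poly_exists:
  assumes "rat_eval q z = 0" "q \<noteq> 0"
  obtains f where "f \<noteq> 0" "\<And>p. rat_eval p z = 0 \<longleftrightarrow> f dvd p"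
proof -
  obtain f where f: "rat_eval f z = 0" "f \<noteq> 0"
    and min: "\<And>g. rat_eval g z = 0 \<Longrightarrow> g \<noteq> 0 \<Longrightarrow> degree f \<le> degree g"
    using ex_has_least_nat[of "\<lambda>f. rat_eval f z = 0 \<and> f \<noteq> 0" q degree] assms by auto
  have "f dvd p" if "rat_eval p z = 0" for p
  proof -
    have "rat_eval (p mod f) z = rat_eval (p - p div f * f) z"
      by (simp add: minus_div_mult_eq_mod)
    also have "\<dots> = 0" using that f(1) by simp
    finally have "p mod f = 0" using min[of "p mod f"] degree_mod_less[OF f(2), of p]
      by (metis not_le)
    then show ?thesis by (simp add: dvd_eq_mod_eq_0)
  qed
  then show ?thesis using that f rat_eval_dvd by blast
qed

section \<open>Irreducibility of the cyclotomic polynomials\<close>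

text \<open>The inner binomial coefficients are divisible by \<open>p\<close>. The general ring
  covers both integers and integer polynomials.\<close>

lemma prime_dvd_binomial_power:
  fixes x y :: "'a::comm_ring_1"
  assumes "prime p"
  shows "of_nat p dvd (x + y) ^ p - x ^ p - y ^ p"
proof -
  have p: "p > 0" using assms prime_gt_0_nat by blast
  let ?t = "\<lambda>k. of_nat (p choose k) * x ^ k * y ^ (p - k)"
  have "{..p} = insert 0 (insert p {1..<p})" by auto
  then have "(x + y) ^ p = y ^ p + (x ^ p + (\<Sum>k\<in>{1..<p}. ?t k))"
    using p by (simp add: binomial_ring)
  moreover have "of_nat p dvd (\<Sum>k\<in>{1..<p}. ?t k)"
  proof (intro dvd_sum)
    fix k assume "k \<in> {1..<p}"
    then have "p dvd (p choose k)"
      using assms by (intro dvd_choose_prime) auto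
    then show "of_nat p dvd ?t k" by (auto simp: of_nat_mult mult.assoc elim!: dvdE)
  qed
  ultimately show ?thesis by simp
qed

text \<open>Fermat's little theorem, by induction on \<open>a\<close> in both directions from
  0.\<close>

lemma prime_dvd_int_power_diff:
  fixes a :: int
  assumes "prime p"
  shows "of_nat p dvd a ^ p - a"
proof -
  have p: "p > 0" using assms prime_gt_0_nat by blast
  show ?thesis
  proof (induction a rule: int_induct[where k = 0])
    case base
    then show ?case using p by (simp add: zero_power)
  next
    case (step1 i)
    have "(i + 1) ^ p - (i + 1) = ((i + 1) ^ p - i ^ p - 1 ^ p) + (i ^ p - i)" by simp
    then show ?case using step1 prime_dvd_binomial_power[OF assms, of i 1] by (metis dvd_add)
  next
    case (step2 i)
    have "(i - 1) ^ p - (i - 1) = (i ^ p - i) - (((i - 1) + 1) ^ p - (i - 1) ^ p - 1 ^ p)" by simp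
    then show ?case using step2 prime_dvd_binomial_power[OF assms, of "i - 1" 1] by (metis dvd_diff)
  qed
qed

text \<open>The Frobenius congruence: split off the constant coefficient \<open>a\<close>, expand
  the power by the binomial congruence, and use Fermat's theorem for \<open>a\<close>.\<close>

lemma prime_dvd_pcompose_monom_diff:
  fixes f :: "int poly"
  assumes "prime p"
  shows "of_nat p dvd pcompose f (monom 1 p) - f ^ p"
proof (induction f)
  case 0
  then show ?case using prime_gt_0_nat[OF assms] by (simp add: zero_power)
next
  case (pCons a f)
  let ?x = "monom 1 1 :: int poly"
  have eq: "pCons a f = [:a:] + ?x * f" by (simp add: monom_altdef)
  have "of_nat p dvd (pCons a f) ^ p - [:a:] ^ p - (?x * f) ^ p"
    unfolding eq by (rule prime_dvd_binomial_power[OF assms])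
  moreover have "of_nat p dvd [:a:] ^ p - [:a:]"
  proof -
    obtain b where "a ^ p - a = of_nat p * b"
      using prime_dvd_int_power_diff[OF assms, of a] by (auto elim: dvdE)
    then have "[:a:] ^ p - [:a:] = of_nat p * [:b:]"
      by (simp add: poly_const_pow of_nat_poly)
    then show ?thesis by (rule dvdI)
  qed
  moreover have "of_nat p dvd ?x ^ p * (pcompose f (monom 1 p) - f ^ p)"
    using pCons.IH by simp
  ultimately have "of_nat p dvd ?x ^ p * (pcompose f (monom 1 p) - f ^ p)
      - ((pCons a f) ^ p - [:a:] ^ p - (?x * f) ^ p) - ([:a:] ^ p - [:a:])"
    by (meson dvd_diff)
  moreover have "?x ^ p = monom 1 p" by (simp add: monom_power)
  ultimately show ?case
    by (simp add: pcompose_pCons power_mult_distrib algebra_simps)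
qed

lemma common_denominator:
  fixes S :: "rat set"
  assumes "finite S"
  obtains b :: int where "b > 0" "\<And>x. x \<in> S \<Longrightarrow> of_int b * x \<in> \<int>"
proof -
  have "\<exists>b::int. b > 0 \<and> (\<forall>x\<in>S. of_int b * x \<in> \<int>)"
    using assms
  proof (induction S)
    case empty
    then show ?case by (auto intro: exI[of _ 1])
  next
    case (insert x S)
    then obtain b :: int where b: "b > 0" "\<forall>y\<in>S. of_int b * y \<in> \<int>" by blast
    obtain m n where x: "quotient_of x = (m, n)" by (cases "quotient_of x")
    have n: "n > 0" "x = of_int m / of_int n"
      using quotient_of_denom_pos[OF x] quotient_of_div[OF x] by auto
    have "of_int (b * n) * y \<in> \<int>" if y: "y \<in> insert x S" for y
    proof (cases "y = x")
      case True
      then have "of_int (b * n) * y = of_int (b * m)" using n by simp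
      then show ?thesis by (metis Ints_of_int)
    next
      case False
      then have "of_int (b * n) * y = of_int n * (of_int b * y)" by simp
      moreover have "of_int b * y \<in> \<int>" using False y b by blast
      ultimately show ?thesis by (metis Ints_mult Ints_of_int)
    qed
    then show ?case using b n by (intro exI[of _ "b * n"]) auto
  qed
  then show ?thesis using that by blast
qed

lemma nonzero_coeff_in_coeffs: "coeff p i \<noteq> 0 \<Longrightarrow> coeff p i \<in> set (coeffs p)"
  by (metis coeff_0 coeff_in_coeffs le_degree)

lemma int_poly_multiple_exists:
  fixes q :: "rat poly"
  obtains b :: int and f :: "int poly" where "b > 0" "map_poly of_int f = smult (of_int b) q"
proof -
  obtain b :: int where b: "b > 0" "\<And>x. x \<in> set (coeffs q) \<Longrightarrow> of_int b * x \<in> \<int>"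
    using common_denominator[of "set (coeffs q)"] by auto
  have "of_int b * coeff q i \<in> \<int>" for i
    using b(2)[of "coeff q i"] by (cases "coeff q i = 0") (auto intro: nonzero_coeff_in_coeffs)
  then have "map_poly of_int (map_poly floor (smult (of_int b) q)) = smult (of_int b) q"
    by (intro poly_eqI) (simp add: coeff_map_poly)
  then show ?thesis using that b(1) by blast
qed

lemma map_poly_of_int_add: "map_poly of_int (p + q) = (map_poly of_int p + map_poly of_int q :: rat poly)"
  by (intro poly_eqI) (simp add: coeff_map_poly)

lemma map_poly_of_int_mult: "map_poly of_int (p * q) = (map_poly of_int p * map_poly of_int q :: rat poly)"
  by (intro poly_eqI) (simp add: coeff_map_poly coeff_mult)

lemma map_poly_of_int_power: "map_poly of_int (p ^ n) = (map_poly of_int p ^ n :: rat poly)"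
  by (induction n) (simp_all add: map_poly_of_int_mult)

lemma map_poly_of_int_pcompose:
  "map_poly of_int (pcompose p q) = (pcompose (map_poly of_int p) (map_poly of_int q) :: rat poly)"
  by (induction p) (simp_all add: pcompose_pCons map_poly_of_int_add map_poly_of_int_mult map_poly_pCons)

text \<open>Landau's proof of the irreducibility of the cyclotomic polynomials: \<open>f(x ^ p) = f(x) ^ p + p * g(x)\<close>,
  so the coordinates of \<open>f(z ^ p)\<close> in the basis of powers of \<open>z\<close> are divisible by \<open>p\<close> up to a fixed
  denominator. They are also bounded independently of \<open>p\<close>, since \<open>z ^ p\<close> depends only on \<open>p mod n\<close>.\<close>

lemma root_of_unity_power_large_prime:
  fixes f :: "int poly"
  assumes z: "z ^ n = 1" "n > 0" and f: "rat_eval (map_poly of_int f) z = 0"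
  obtains A :: nat where "\<And>p. prime p \<Longrightarrow> p > A \<Longrightarrow> rat_eval (map_poly of_int f) (z ^ p) = 0"
proof -
  let ?I = "map_poly of_int :: int poly \<Rightarrow> rat poly"
  have "rat_eval (monom 1 n - 1) z = 0" using z by simp
  moreover have "monom 1 n - 1 \<noteq> (0 :: rat poly)"
    using z(2) by (metis degree_1 degree_monom_eq eq_iff_diff_eq_0 less_irrefl zero_neq_one)
  ultimately obtain m where m: "m \<noteq> 0" "\<And>p. rat_eval p z = 0 \<longleftrightarrow> m dvd p"
    using minimal_poly_exists by blast
  \<comment> \<open>The remainder modulo \<open>m\<close> lists the coordinates of the value at
    \<open>z\<close> in the basis of powers of \<open>z\<close>.\<close>
  have cong: "p mod m = q mod m" if "rat_eval p z = rat_eval q z" for p q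
    using that m(2)[of "p - q"] by (simp add: mod_eq_dvd_iff)
  have pow: "z ^ (j mod n) = z ^ j" for j
  proof -
    have "z ^ j = z ^ (j mod n + n * (j div n))" by simp
    also have "\<dots> = z ^ (j mod n)" unfolding power_add power_mult using z by simp
    finally show ?thesis by simp
  qed
  let ?S = "\<Union>j\<in>{..<n}. set (coeffs (monom 1 j mod m))"
  obtain B :: int where B: "B > 0" "\<And>x. x \<in> ?S \<Longrightarrow> of_int B * x \<in> \<int>"
    using common_denominator[of ?S] by auto
  have B_monom: "of_int B * coeff (monom 1 j mod m) i \<in> \<int>" for i j
  proof -
    have "monom 1 j mod m = monom 1 (j mod n) mod m"
      by (intro cong) (simp add: pow)
    moreover have "of_int B * coeff (monom 1 (j mod n) mod m) i \<in> \<int>"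
    proof (cases "coeff (monom 1 (j mod n) mod m) i = 0")
      case False
      then show ?thesis using z(2) by (intro B(2) UN_I[of "j mod n"] nonzero_coeff_in_coeffs) auto
    qed simp
    ultimately show ?thesis by simp
  qed
  \<comment> \<open>The factor \<open>monom 1 j\<close> is there for the induction: removing the
    constant coefficient of the polynomial shifts the rest by one power.\<close>
  have B_int: "of_int B * coeff ((monom 1 j * ?I g) mod m) i \<in> \<int>" for g i j
  proof (induction g arbitrary: j)
    case (pCons a g)
    have "monom 1 j * ?I (pCons a g) = smult (of_int a) (monom 1 j) + monom 1 (Suc j) * ?I g"
      by (simp add: map_poly_pCons monom_Suc mult_pCons_right)
    then have "of_int B * coeff ((monom 1 j * ?I (pCons a g)) mod m) i
        = of_int a * (of_int B * coeff (monom 1 j mod m) i) + of_int B * coeff ((monom 1 (Suc j) * ?I g) mod m) i"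
      by (simp only: poly_mod_add_left mod_smult_left) (simp add: algebra_simps)
    then show ?case using pCons.IH B_monom by simp
  qed simp
  let ?c = "\<lambda>r i. coeff (pcompose (?I f) (monom 1 r) mod m) i"
  let ?C = "\<Union>r\<in>{..<n}. set (coeffs (pcompose (?I f) (monom 1 r) mod m))"
  define A where "A = nat \<lceil>of_int B * (\<Sum>x\<in>?C. \<bar>x\<bar>)\<rceil>"
  have A: "of_int B * \<bar>?c p i\<bar> \<le> of_nat A" for p i
  proof -
    have eq: "?c p i = ?c (p mod n) i"
      by (intro arg_cong2[of _ _ _ _ coeff] cong) (simp_all add: pow)
    have "\<bar>?c p i\<bar> \<le> (\<Sum>x\<in>?C. \<bar>x\<bar>)"
    proof (cases "?c p i = 0")
      case False
      then have "?c p i \<in> ?C"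
        unfolding eq using z(2) by (auto intro!: bexI[of _ "p mod n"] nonzero_coeff_in_coeffs)
      then show ?thesis by (intro member_le_sum) auto
    qed (simp add: sum_nonneg)
    then have "of_int B * \<bar>?c p i\<bar> \<le> of_int B * (\<Sum>x\<in>?C. \<bar>x\<bar>)"
      using B(1) by (intro mult_left_mono) auto
    also have "\<dots> \<le> of_nat A" unfolding A_def by (rule of_nat_ceiling)
    finally show ?thesis .
  qed
  show ?thesis
  proof (rule that)
    fix p assume p: "prime p" "p > A"
    obtain g where g: "pcompose f (monom 1 p) - f ^ p = of_nat p * g"
      using prime_dvd_pcompose_monom_diff[OF p(1), of f] by (auto elim: dvdE)
    then have "pcompose f (monom 1 p) = f ^ p + of_nat p * g" by (simp add: algebra_simps)
    then have "?I (pcompose f (monom 1 p)) = ?I f ^ p + ?I (of_nat p) * ?I g"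
      by (simp add: map_poly_of_int_add map_poly_of_int_mult map_poly_of_int_power)
    then have eq: "pcompose (?I f) (monom 1 p) = ?I f ^ p + smult (of_nat p) (?I g)"
      by (simp add: map_poly_of_int_pcompose map_poly_monom of_nat_poly map_poly_pCons)
    \<comment> \<open>At \<open>z\<close> the summand \<open>f^p\<close> vanishes, so only the
      multiple of \<open>p\<close> survives.\<close>
    have mod: "pcompose (?I f) (monom 1 p) mod m = smult (of_nat p) (?I g mod m)"
      unfolding mod_smult_left[symmetric] eq
      using f prime_gt_0_nat[OF p(1)] by (intro cong) simp
    have "?c p i = 0" for i
    proof -
      obtain k where k: "of_int B * coeff (?I g mod m) i = of_int k"
        using B_int[of 0 g i] by (auto elim: Ints_cases)
      have "of_int B * \<bar>?c p i\<bar> = \<bar>of_nat p * (of_int B * coeff (?I g mod m) i)\<bar>"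
        using B(1) by (simp add: mod abs_mult)
      also have "\<dots> = rat_of_int (int p * \<bar>k\<bar>)" unfolding k by (simp add: abs_mult)
      finally have "rat_of_int (int p * \<bar>k\<bar>) \<le> of_int (int A)" using A[of p i] by simp
      then have "int p * \<bar>k\<bar> \<le> int A" by (simp only: of_int_le_iff)
      moreover have "int p * \<bar>k\<bar> \<ge> int p" if "k \<noteq> 0"
        using that mult_left_mono[of 1 "\<bar>k\<bar>" "int p"] by simp
      ultimately have "k = 0" using p(2) by linarith
      then show ?thesis using k B(1) by (simp add: mod)
    qed
    then have "pcompose (?I f) (monom 1 p) mod m = 0" by (intro poly_eqI) simp
    then have "m dvd pcompose (?I f) (monom 1 p)" by (simp add: dvd_eq_mod_eq_0)
    then show "rat_eval (?I f) (z ^ p) = 0" using m(2)[of "pcompose (?I f) (monom 1 p)"] by simp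
  qed
qed

text \<open>Vanishing passes from \<open>z\<close> to \<open>z^p\<close> for large primes
  \<open>p\<close>, hence to exponents with only large prime factors. The residue class of
  \<open>k\<close> modulo \<open>n\<close> contains such an exponent, an elementary fact that takes
  the place of Dirichlet's theorem.\<close>

lemma rat_eval_coprime_power:
  assumes z: "z ^ n = 1" "n > 0" and q: "rat_eval q z = 0" and k: "coprime k n"
  shows "rat_eval q (z ^ k) = 0"
proof (cases "q = 0")
  case False
  then obtain m where m: "m \<noteq> 0" "\<And>p. rat_eval p z = 0 \<longleftrightarrow> m dvd p"
    using minimal_poly_exists q by blast
  obtain b :: int and f where f: "b > 0" "map_poly of_int f = smult (of_int b) m"
    by (rule int_poly_multiple_exists)
  have m_root: "rat_eval m z = 0" using m(2) by simp
  obtain A :: nat where A: "\<And>p. prime p \<Longrightarrow> p > A \<Longrightarrow> rat_eval m (z ^ p) = 0"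
    using root_of_unity_power_large_prime[OF z, of f] f m_root by auto
  \<comment> \<open>Peel off one prime \<open>p\<close> of \<open>j = p * i\<close>: since
    \<open>m\<close> vanishes at \<open>z^p\<close>, it divides \<open>m(x^p)\<close>, so a zero at
    \<open>z^i\<close> gives one at \<open>z^j\<close>.\<close>
  have rough: "rat_eval m (z ^ j) = 0" if "j > 0" "\<And>p. prime p \<Longrightarrow> p dvd j \<Longrightarrow> p > A" for j
    using that
  proof (induction j rule: less_induct)
    case (less j)
    show ?case
    proof (cases "j = 1")
      case False
      then obtain p where p: "prime p" "p dvd j" using prime_factor_nat by blast
      then obtain i where i: "j = p * i" by (auto elim: dvdE)
      have "i < j" "i > 0" using i less.prems(1) prime_gt_1_nat[OF p(1)] by auto
      then have "rat_eval m (z ^ i) = 0" using less i by auto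
      moreover have "m dvd pcompose m (monom 1 p)"
        using A[OF p(1) less.prems(2)[OF p]] m(2)[of "pcompose m (monom 1 p)"] by simp
      ultimately have "rat_eval (pcompose m (monom 1 p)) (z ^ i) = 0" by (rule rat_eval_dvd[rotated])
      then show ?thesis by (simp add: i mult.commute flip: power_mult)
    qed (use m_root in simp)
  qed
  \<comment> \<open>an exponent congruent to \<open>k\<close> modulo \<open>n\<close> without prime factors up to \<open>A\<close>\<close>
  let ?Q = "{p. prime p \<and> p \<le> A \<and> \<not> p dvd k}"
  let ?k = "k + n * \<Prod>?Q"
  have finQ: "finite ?Q" by (rule finite_subset[of _ "{..A}"]) auto
  have "rat_eval m (z ^ ?k) = 0"
  proof (rule rough)
    have "\<Prod>?Q > 0" by (intro prod_pos) (auto intro: prime_gt_0_nat)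
    then show "?k > 0" using z(2) by simp
    fix p :: nat assume p: "prime p" "p dvd ?k"
    show "p > A"
    proof (rule ccontr)
      assume "\<not> p > A"
      show False
      \<comment> \<open>A prime dividing \<open>k\<close> divides neither \<open>n\<close>, by
        coprimality, nor the product, whose prime factors avoid \<open>k\<close>. A prime up to
        \<open>A\<close> not dividing \<open>k\<close> occurs in the product and would have to
        divide \<open>k\<close> after all.\<close>
      proof (cases "p dvd k")
        case True
        then have "p dvd n * \<Prod>?Q" using p(2) by (simp add: dvd_add_right_iff)
        moreover have "\<not> p dvd n"
          using True k p(1) by (meson coprime_common_divisor not_prime_unit)
        ultimately have "p dvd \<Prod>?Q" using p(1) prime_dvd_multD by blast
        then obtain r where "r \<in> ?Q" "p dvd r"
          using prime_dvd_prod_iff[OF finQ p(1), of "\<lambda>p. p"] by auto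
        then show False using p(1) True primes_dvd_imp_eq by blast
      next
        case False
        then have "p \<in> ?Q" using p(1) \<open>\<not> p > A\<close> by simp
        then have "p dvd n * \<Prod>?Q" using dvd_prodI[OF finQ, of p "\<lambda>p. p"] by simp
        then have "p dvd k" using p(2) by (simp add: dvd_add_left_iff)
        then show False using False by simp
      qed
    qed
  qed
  moreover have "z ^ ?k = z ^ k" using z by (simp add: power_add power_mult)
  ultimately show ?thesis using m(2)[of q] q rat_eval_dvd by metis
qed simp

section \<open>Primitive roots of unity\<close>

definition primitive_root_of_unity :: "nat \<Rightarrow> complex \<Rightarrow> bool" where
  "primitive_root_of_unity n z \<longleftrightarrow> n > 0 \<and> (\<forall>k. z ^ k = 1 \<longleftrightarrow> n dvd k)"

lemma primitive_root_of_unityD: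
  assumes "primitive_root_of_unity n z"
  shows "n > 0" "z ^ n = 1" "z \<noteq> 0" "z ^ k = 1 \<longleftrightarrow> n dvd k"
proof -
  show n: "n > 0" and zn: "z ^ n = 1" and "z ^ k = 1 \<longleftrightarrow> n dvd k"
    using assms by (auto simp: primitive_root_of_unity_def)
  show "z \<noteq> 0" using n zn by (auto simp: zero_power)
qed

lemma primitive_root_of_unity_exists:
  assumes "z ^ m = 1" "m > 0"
  obtains n where "primitive_root_of_unity n z"
proof -
  define n where "n = (LEAST n. n > 0 \<and> z ^ n = 1)"
  have n: "n > 0" "z ^ n = 1"
    using LeastI[of "\<lambda>n. n > 0 \<and> z ^ n = 1" m] assms by (auto simp: n_def)
  have "n dvd k" if "z ^ k = 1" for k
  proof -
    have "z ^ (k mod n + n * (k div n)) = 1" using that by simp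
    then have "z ^ (k mod n) = 1" unfolding power_add power_mult using n by simp
    moreover have "k mod n < n" using n by simp
    ultimately have "k mod n = 0"
      using not_less_Least[of "k mod n" "\<lambda>n. n > 0 \<and> z ^ n = 1"] unfolding n_def by auto
    then show ?thesis by auto
  qed
  moreover have "z ^ k = 1" if "n dvd k" for k using that n by (auto simp: power_mult elim!: dvdE)
  ultimately have "primitive_root_of_unity n z"
    unfolding primitive_root_of_unity_def using n by blast
  then show ?thesis by (rule that)
qed

lemma primitive_root_of_unity_inj_on:
  assumes "primitive_root_of_unity n z"
  shows "inj_on ((^) z) {..<n}"
proof (rule linorder_inj_onI)
  fix i j assume "i < j" "i \<in> {..<n}" "j \<in> {..<n}"
  note z = primitive_root_of_unityD[OF assms]
  show "z ^ i \<noteq> z ^ j"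
  proof
    assume eq: "z ^ i = z ^ j"
    have "z ^ j = z ^ i * z ^ (j - i)" using \<open>i < j\<close> by (simp flip: power_add)
    then have "z ^ (j - i) = 1" using eq z(3) by simp
    then show False using z(4)[of "j - i"] \<open>i < j\<close> \<open>j \<in> {..<n}\<close> by (auto dest: dvd_imp_le)
  qed
qed auto

text \<open>The \<open>n\<close> distinct powers of \<open>z\<close> exhaust the solutions of
  \<open>x^n = 1\<close>, so \<open>w = z^k\<close>. With \<open>g = gcd k n\<close> the power
  \<open>w^(n / g)\<close> is 1, and the order \<open>n\<close> of \<open>w\<close> forces
  \<open>g = 1\<close>.\<close>

lemma primitive_root_of_unity_eq_power:
  assumes z: "primitive_root_of_unity n z" and w: "primitive_root_of_unity n w"
  obtains k where "coprime k n" "w = z ^ k"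
proof -
  note zD = primitive_root_of_unityD[OF z] and wD = primitive_root_of_unityD[OF w]
  have "(^) z ` {..<n} \<subseteq> {x. x ^ n = 1}"
  proof clarify
    fix i
    have "(z ^ i) ^ n = (z ^ n) ^ i" by (simp only: mult.commute flip: power_mult)
    then show "(z ^ i) ^ n = 1" using zD by simp
  qed
  moreover have "card ((^) z ` {..<n}) = n"
    using primitive_root_of_unity_inj_on[OF z] by (simp add: card_image)
  ultimately have "(^) z ` {..<n} = {x. x ^ n = 1}"
    using zD(1) finite_roots_unity[of n, where 'a = complex] card_roots_unity[of n, where 'a = complex]
    by (intro card_seteq) simp_all
  then obtain k where k: "w = z ^ k" using wD(2) by blast
  let ?g = "gcd k n"
  have "w ^ (n div ?g) = (z ^ n) ^ (k div ?g)"
    by (simp add: k div_mult_swap dvd_div_mult flip: power_mult) (metis div_mult_swap dvd_div_mult gcd_dvd1 gcd_dvd2 mult.commute)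
  then have "n dvd n div ?g" using zD wD by simp
  moreover have "n div ?g > 0" using zD(1) by (simp add: div_greater_zero_iff gcd_le2_nat)
  ultimately have "n \<le> n div ?g" by (rule dvd_imp_le)
  then have "\<not> 1 < ?g" using zD(1) div_less_dividend[of ?g n] by linarith
  moreover have "?g > 0" using zD(1) by simp
  ultimately have "?g = 1" by linarith
  then show ?thesis using that k by (simp add: coprime_iff_gcd_eq_1)
qed

section \<open>Degrees of the values (z + 1 / z) / 2\<close>

text \<open>For \<open>z = u(a) + v(a) * sqrt (D(a))\<close> the conjugate is \<open>1 / z\<close>,
  so this map recovers \<open>u(a)\<close>.\<close>

definition joukowski :: "complex \<Rightarrow> complex" where
  "joukowski z = (z + 1 / z) / 2"

text \<open>As \<open>1 / z = z^(n - 1)\<close>, the value \<open>joukowski z\<close> is a rational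
  polynomial in \<open>z\<close>, and composing \<open>q\<close> with it reduces the claim to powers
  of \<open>z\<close>.\<close>

lemma rat_eval_joukowski_conjugate:
  assumes z: "primitive_root_of_unity n z" and q: "rat_eval q (joukowski z) = 0" and k: "coprime k n"
  shows "rat_eval q (joukowski (z ^ k)) = 0"
proof -
  note zD = primitive_root_of_unityD[OF z]
  let ?j = "monom (1/2) 1 + monom (1/2) (n - 1) :: rat poly"
  have eval: "rat_eval ?j w = joukowski w" if "w ^ n = 1" for w
  proof -
    have "w \<noteq> 0" using that zD(1) by (auto simp: zero_power)
    moreover have "w ^ (n - 1) * w = 1" using that zD(1) by (simp flip: power_Suc2)
    ultimately have "w ^ (n - 1) = 1 / w" by (simp add: field_simps)
    then show ?thesis by (simp add: joukowski_def of_rat_divide)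
  qed
  have "(z ^ k) ^ n = (z ^ n) ^ k" by (simp only: mult.commute flip: power_mult)
  then have zk: "(z ^ k) ^ n = 1" using zD by simp
  have "rat_eval (pcompose q ?j) z = 0" using q eval zD by simp
  then have "rat_eval (pcompose q ?j) (z ^ k) = 0"
    using rat_eval_coprime_power zD k by blast
  then show ?thesis using eval[OF zk] by simp
qed

text \<open>The \<open>phi(n)\<close> conjugates of \<open>z\<close> are sent by
  \<open>joukowski\<close> to roots of \<open>q\<close>, and at most two of them, the roots of
  \<open>w^2 - 2 * s * w + 1\<close>, to the same root \<open>s\<close>.\<close>

lemma totient_le_degree:
  assumes z: "primitive_root_of_unity n z" and q: "rat_eval q (joukowski z) = 0" "q \<noteq> 0"
  shows "totient n \<le> 2 * degree q"
proof -
  note zD = primitive_root_of_unityD[OF z]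
  let ?R = "{s. rat_eval q s = 0}" and ?W = "(^) z ` {k. k < n \<and> coprime k n}"
  let ?F = "\<lambda>s. {w. w\<^sup>2 - 2 * s * w + 1 = 0} :: complex set"
  have F: "finite (?F s) \<and> card (?F s) \<le> 2" for s
  proof -
    have "?F s = {w. poly [:1, - 2 * s, 1:] w = 0}" by (auto simp: algebra_simps power2_eq_square)
    moreover have "[:1, - 2 * s, 1:] \<noteq> 0" by simp
    ultimately show ?thesis
      using poly_roots_finite[of "[:1, - 2 * s, 1:]"] card_poly_roots_bound[of "[:1, - 2 * s, 1:]"] by simp
  qed
  have sub: "?W \<subseteq> (\<Union>s\<in>?R. ?F s)"
  proof clarify
    fix k assume "k < n" "coprime k n"
    then have "rat_eval q (joukowski (z ^ k)) = 0"
      using rat_eval_joukowski_conjugate[OF z q(1)] by blast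
    moreover have "z ^ k \<in> ?F (joukowski (z ^ k))"
      using zD(3) by (simp add: joukowski_def field_simps power2_eq_square)
    ultimately show "z ^ k \<in> (\<Union>s\<in>?R. ?F s)" by blast
  qed
  have "card ?W = card {k. k < n \<and> coprime k n}"
    using primitive_root_of_unity_inj_on[OF z] by (intro card_image) (auto simp: inj_on_def)
  also have "\<dots> \<ge> totient n"
  \<comment> \<open>Totatives lie in \<open>1..n\<close>, the exponents in \<open>0..n - 1\<close>.
    The sets differ only for \<open>n = 1\<close>, where the exponent 0 replaces the totative
    1.\<close>
  proof (cases "n = 1")
    case False
    then have "totatives n = {k. k < n \<and> coprime k n}"
      using zD(1) by (auto simp: totatives_def le_less intro: Nat.gr0I)
    then show ?thesis by (simp add: totient_def)
  qed simp
  finally have "totient n \<le> card ?W" .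
  also have "\<dots> \<le> card (\<Union>s\<in>?R. ?F s)"
    using rat_eval_roots[OF q(2)] F sub by (intro card_mono) auto
  also have "\<dots> \<le> (\<Sum>s\<in>?R. card (?F s))"
    using rat_eval_roots[OF q(2)] by (intro card_UN_le)
  also have "\<dots> \<le> (\<Sum>s\<in>?R. 2)" using F by (intro sum_mono) auto
  also have "\<dots> \<le> 2 * degree q" using rat_eval_roots[OF q(2)] by simp
  finally show ?thesis .
qed

text \<open>The \<open>degree P + 1\<close> powers \<open>u ^ i\<close> are linearly dependent modulo \<open>P\<close>.\<close>

lemma dvd_pcompose_exists:
  fixes P u :: "'a::field poly"
  assumes "P \<noteq> 0"
  obtains q where "q \<noteq> 0" "degree q \<le> degree P" "P dvd pcompose q u"
proof -
  interpret vector_space "smult :: 'a \<Rightarrow> 'a poly \<Rightarrow> 'a poly"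
    by unfold_locales (simp_all add: smult_add_right smult_add_left)
  let ?e = "degree P"
  define s where "s i = u ^ i mod P" for i
  have mon: "pcompose (monom 1 i) u = u ^ i" for i :: nat
    by (induction i) (simp_all add: monom_Suc pcompose_pCons pcompose_1)
  show ?thesis
  \<comment> \<open>Linear dependence is a property of the set of remainders, so two powers with
    equal remainders are handled apart, by a difference of monomials.\<close>
  proof (cases "inj_on s {..?e}")
    case False
    then obtain i j where ij: "i \<le> ?e" "j \<le> ?e" "i \<noteq> j" "s i = s j"
      by (auto simp: inj_on_def)
    let ?q = "monom 1 i - monom 1 j :: 'a poly"
    have "coeff ?q i = 1" using ij(3) by simp
    then have "?q \<noteq> 0" by fastforce
    moreover have "degree ?q \<le> ?e" using ij by (intro degree_diff_le) (simp_all add: degree_monom_eq)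
    moreover have "P dvd pcompose ?q u"
      using ij(4) by (simp add: pcompose_diff mon s_def mod_eq_dvd_iff)
    ultimately show ?thesis by (rule that)
  next
    case True
    let ?T = "(\<lambda>i. monom 1 i :: 'a poly) ` {..<?e}"
    have "s ` {..?e} \<subseteq> span ?T"
    proof clarify
      fix i
      have "coeff (s i) k = 0" if "k \<ge> ?e" for k
        using degree_mod_less[OF assms, of "u ^ i"] that
        by (auto simp: s_def intro: coeff_eq_0)
      then have "s i = (\<Sum>k<?e. smult (coeff (s i) k) (monom 1 k))"
        by (intro poly_eqI) (auto simp: coeff_sum not_less if_distrib cong: if_cong)
      also have "\<dots> \<in> span ?T"
        by (intro span_sum span_scale span_base) auto
      finally show "s i \<in> span ?T" .
    qed
    moreover have "card ?T \<le> ?e" using card_image_le[of "{..<?e}"] by simp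
    moreover have "card (s ` {..?e}) = Suc ?e" using True by (simp add: card_image)
    ultimately have "dependent (s ` {..?e})"
      using independent_span_bound[of ?T "s ` {..?e}"] by auto
    then obtain c where c: "\<exists>v\<in>s ` {..?e}. c v \<noteq> 0" "(\<Sum>v\<in>s ` {..?e}. smult (c v) v) = 0"
      by (subst (asm) dependent_finite) auto
    define q where "q = (\<Sum>i\<le>?e. monom (c (s i)) i)"
    obtain i where i: "i \<le> ?e" "c (s i) \<noteq> 0" using c(1) by auto
    have "coeff q i = c (s i)"
      using i(1) by (simp add: q_def coeff_sum if_distrib cong: if_cong)
    then have "q \<noteq> 0" using i(2) by auto
    moreover have "degree q \<le> ?e"
      unfolding q_def by (intro degree_sum_le) (auto intro: order.trans[OF degree_monom_le])
    moreover have "P dvd pcompose q u"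
    proof -
      have mod_sum: "(\<Sum>i\<in>A. f i) mod P = (\<Sum>i\<in>A. f i mod P)" for f and A :: "nat set"
        by (induction A rule: infinite_finite_induct) (simp_all add: poly_mod_add_left)
      have "pcompose (monom a i) u = smult a (u ^ i)" for a i
        using pcompose_smult[of a "monom 1 i" u] mon[of i] by (simp add: smult_monom)
      then have "pcompose q u mod P = (\<Sum>i\<le>?e. smult (c (s i)) (s i))"
        by (simp add: q_def pcompose_sum mod_sum mod_smult_left s_def)
      also have "\<dots> = (\<Sum>v\<in>s ` {..?e}. smult (c v) v)"
        using True by (simp add: sum.reindex)
      finally show ?thesis using c(2) by (simp add: dvd_eq_mod_eq_0)
    qed
    ultimately show ?thesis by (rule that)
  qed
qed

section \<open>Irreducible polynomials attached to roots of unity of a given order\<close>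

text \<open>Distinct monic irreducibles are coprime, so the product of finitely many of them divides
  \<open>Q\<close>, and degrees can be compared. Bounding all finite subsets also yields
  finiteness.\<close>

lemma card_monic_irreducible_divisors:
  fixes Q :: "'a::field poly"
  assumes "Q \<noteq> 0" "d > 0"
    and S: "\<And>P. P \<in> S \<Longrightarrow> lead_coeff P = 1 \<and> irreducible P \<and> P dvd Q \<and> degree P \<ge> d"
  shows "finite S \<and> d * card S \<le> degree Q"
proof -
  have prod_dvd: "\<Prod>F dvd Q" if "finite F" "F \<subseteq> S" for F
    using that
  proof (induction F)
    case (insert P F)
    then obtain h where h: "Q = \<Prod>F * h" by (auto elim: dvdE)
    have P: "lead_coeff P = 1" "irreducible P" "P dvd Q" using S insert.prems by auto
    then have prime: "prime_elem P" by (intro field_poly_irreducible_imp_prime)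
    have "\<not> P dvd \<Prod>F"
    proof
      assume "P dvd \<Prod>F"
      with insert.hyps(1) have "\<exists>R\<in>F. P dvd R"
      proof (induction F rule: finite_induct)
        case empty
        then show ?case using prime_elem_not_unit[OF prime] by simp
      next
        case (insert R F)
        then have "P dvd R \<or> P dvd \<Prod>F" using prime by (simp add: prime_elem_dvd_mult_iff)
        then show ?case using insert.IH by blast
      qed
      then obtain R where R: "R \<in> F" "P dvd R" by blast
      then have R': "lead_coeff R = 1" "irreducible R" using S insert.prems by auto
      obtain c where c: "R = P * c" using R(2) by (auto elim: dvdE)
      have "\<not> P dvd 1" using P(2) by (simp add: irreducible_def)
      then have "c dvd 1" using R'(2) c by (auto dest: irreducibleD)
      then obtain a where "c = [:a:]" by (auto simp: is_unit_poly_iff)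
      moreover from this have "a = 1" using c P(1) R'(1) by (cases "a = 0") auto
      ultimately have "R = P" using c by simp
      then show False using R(1) insert.hyps(2) by simp
    qed
    then have "P dvd h" using P(3) prime unfolding h by (simp add: prime_elem_dvd_mult_iff)
    then show ?case using insert.hyps unfolding h by (auto simp: mult.commute elim!: dvdE)
  qed simp
  have "d * card F \<le> degree Q" if F: "finite F" "F \<subseteq> S" for F
  proof -
    have "P \<noteq> 0" if "P \<in> F" for P using S[of P] F that by auto
    then have "degree (\<Prod>F) = (\<Sum>P\<in>F. degree P)"
      using degree_prod_eq_sum_degree[of F "\<lambda>P. P"] by simp
    also have "\<dots> \<ge> (\<Sum>P\<in>F. d)" using S F(2) by (intro sum_mono) auto
    finally show ?thesis
      using dvd_imp_degree_le[OF prod_dvd[OF F] assms(1)] by (simp add: mult.commute)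
  qed
  note bound = this
  have "card F \<le> degree Q" if "F \<subseteq> S" "finite F" for F
    using bound[OF that(2,1)] \<open>d > 0\<close> by (metis le_trans mult_le_mono1 nat_mult_1 Suc_leI One_nat_def)
  then have "finite S" using finite_if_finite_subsets_card_bdd by blast
  then show ?thesis using bound by blast
qed

text \<open>Up to a unit, \<open>P\<close> is the minimal polynomial of \<open>z\<close>.\<close>

lemma irreducible_dvd_if_root:
  assumes "irreducible P" "rat_eval P z = 0" "rat_eval h z = 0"
  shows "P dvd h"
proof -
  have "P \<noteq> 0" using assms by auto
  then obtain m where m: "m \<noteq> 0" "\<And>p. rat_eval p z = 0 \<longleftrightarrow> m dvd p"
    using minimal_poly_exists assms(2) by blast
  obtain c where c: "P = m * c" using m(2) assms(2) by (auto elim: dvdE)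
  have "\<not> m dvd 1" using m(2)[of 1] by simp
  then have "c dvd 1" using c assms(1) irreducibleD by blast
  then have "P dvd m" unfolding c by (metis dvd_refl mult_dvd_mono mult_1_right)
  moreover have "m dvd h" using m(2) assms(3) by simp
  ultimately show ?thesis by (rule dvd_trans)
qed

text \<open>Sorts the candidates \<open>P\<close> by the order \<open>n\<close> of the root of
  unity. One root \<open>a\<close> represents \<open>P\<close>, since an irreducible polynomial
  determines its roots up to conjugation.\<close>

definition joukowski_fiber :: "rat poly \<Rightarrow> nat \<Rightarrow> rat poly set" where
  "joukowski_fiber u n = {P. lead_coeff P = 1 \<and> irreducible P \<and>
     (\<exists>a z. rat_eval P a = 0 \<and> primitive_root_of_unity n z \<and> rat_eval u a = joukowski z)}"

text \<open>\<open>u(a)\<close> lies in the field generated by \<open>a\<close>, so its degree is at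
  most that of \<open>P\<close>. Conjugation carries this from \<open>z\<close> to any primitive
  root \<open>w\<close>, so that one \<open>w\<close> can serve the whole fiber.\<close>

lemma joukowski_fiber_minimal:
  assumes "P \<in> joukowski_fiber u n" "primitive_root_of_unity n w"
  obtains q where "q \<noteq> 0" "degree q \<le> degree P" "rat_eval q (joukowski w) = 0"
proof -
  obtain a z where P: "irreducible P" "rat_eval P a = 0" "rat_eval u a = joukowski z"
    and z: "primitive_root_of_unity n z"
    using assms(1) by (auto simp: joukowski_fiber_def)
  have "P \<noteq> 0" using P(1) by auto
  then obtain q where q: "q \<noteq> 0" "degree q \<le> degree P" "P dvd pcompose q u"
    using dvd_pcompose_exists by blast
  obtain k where k: "coprime k n" "w = z ^ k"
    using primitive_root_of_unity_eq_power[OF z assms(2)] by blast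
  have "rat_eval q (joukowski z) = 0" using rat_eval_dvd[OF q(3) P(2)] P(3) by simp
  then have "rat_eval q (joukowski w) = 0"
    unfolding k(2) by (rule rat_eval_joukowski_conjugate[OF z _ k(1)])
  then show ?thesis using that q by blast
qed

lemma totient_le_degree_fiber:
  assumes "P \<in> joukowski_fiber u n"
  shows "n > 0" "totient n \<le> 2 * degree P"
proof -
  obtain z where z: "primitive_root_of_unity n z"
    using assms by (auto simp: joukowski_fiber_def)
  show "n > 0" using primitive_root_of_unityD[OF z] by simp
  obtain q where "q \<noteq> 0" "degree q \<le> degree P" "rat_eval q (joukowski z) = 0"
    using joukowski_fiber_minimal[OF assms z] by blast
  then show "totient n \<le> 2 * degree P" using totient_le_degree[OF z] by fastforce
qed

text \<open>The members divide \<open>c(u(t))\<close>, of degree \<open>degree c * degree u\<close>,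
  where \<open>c\<close> is a minimal polynomial of \<open>joukowski w\<close>. Each has degree at
  least \<open>degree c\<close>, so this factor cancels.\<close>

lemma card_joukowski_fiber:
  assumes u: "degree u > 0"
  shows "finite (joukowski_fiber u n) \<and> card (joukowski_fiber u n) \<le> degree u"
proof (cases "joukowski_fiber u n = {}")
  case False
  then obtain P0 where P0: "P0 \<in> joukowski_fiber u n" by blast
  then obtain w where w: "primitive_root_of_unity n w" by (auto simp: joukowski_fiber_def)
  obtain q0 where "q0 \<noteq> 0" "rat_eval q0 (joukowski w) = 0"
    using joukowski_fiber_minimal[OF P0 w] by blast
  then obtain c where c: "c \<noteq> 0" "\<And>p. rat_eval p (joukowski w) = 0 \<longleftrightarrow> c dvd p"
    using minimal_poly_exists by blast
  have deg_c: "degree c > 0"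
  proof (rule ccontr)
    assume "\<not> degree c > 0"
    then have "c dvd 1" using c(1) by (simp add: is_unit_iff_degree)
    then show False using c(2)[of 1] by simp
  qed
  have "finite (joukowski_fiber u n) \<and> degree c * card (joukowski_fiber u n) \<le> degree (pcompose c u)"
  proof (rule card_monic_irreducible_divisors)
    show "pcompose c u \<noteq> 0" using c(1) u by (simp add: pcompose_eq_0_iff)
    show "degree c > 0" by (rule deg_c)
    fix P assume P: "P \<in> joukowski_fiber u n"
    then obtain a z where Pa: "lead_coeff P = 1" "irreducible P" "rat_eval P a = 0" "rat_eval u a = joukowski z"
      and z: "primitive_root_of_unity n z" by (auto simp: joukowski_fiber_def)
    obtain k where k: "coprime k n" "z = w ^ k"
      using primitive_root_of_unity_eq_power[OF w z] by blast
    have "rat_eval c (joukowski w) = 0" using c(2) by simp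
    then have "rat_eval c (joukowski z) = 0"
      unfolding k(2) by (rule rat_eval_joukowski_conjugate[OF w _ k(1)])
    then have "P dvd pcompose c u" using Pa by (intro irreducible_dvd_if_root) auto
    moreover have "degree P \<ge> degree c"
    proof -
      obtain q where "q \<noteq> 0" "degree q \<le> degree P" "rat_eval q (joukowski w) = 0"
        using joukowski_fiber_minimal[OF P w] by blast
      then show ?thesis using c(2) dvd_imp_degree_le by (metis le_trans)
    qed
    ultimately show "lead_coeff P = 1 \<and> irreducible P \<and> P dvd pcompose c u \<and> degree c \<le> degree P"
      using Pa by simp
  qed
  then show ?thesis using deg_c by (simp add: degree_pcompose)
qed simp

subsection \<open>Roots of the Pell polynomials\<close>

lemma rat_eval_all_zero:
  assumes "\<And>z. rat_eval p z = 0"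
  shows "p = 0"
proof (rule ccontr)
  assume "p \<noteq> 0"
  then have "finite {z. rat_eval p z = 0}" by (rule rat_eval_roots)
  then show False using assms infinite_UNIV_char_0[where 'a = complex] by simp
qed

text \<open>The rational identity follows from equality at every complex point.\<close>

lemma pell_solution_rat:
  assumes "pell_solution (map_poly of_rat D :: complex poly) (map_poly of_rat u) (map_poly of_rat v)"
  shows "pell_solution D u v"
proof -
  have "rat_eval (u ^ 2 - D * v ^ 2 - 1) z = 0" for z
  proof -
    have "poly (map_poly of_rat u ^ 2 - map_poly of_rat D * map_poly of_rat v ^ 2) z = 1"
      using assms by (simp add: pell_solution_def)
    then show ?thesis unfolding rat_eval_diff rat_eval_mult rat_eval_power rat_eval_1 by (simp add: rat_eval_def)
  qed
  then show ?thesis using rat_eval_all_zero[of "u ^ 2 - D * v ^ 2 - 1"] by (simp add: pell_solution_def)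
qed

lemma pell_solution_degree_pos:
  fixes D u v :: "'a::field poly"
  assumes D: "degree D > 0" and sol: "pell_solution D u v" and v: "v \<noteq> 0"
  shows "degree u > 0"
proof (rule ccontr)
  assume "\<not> degree u > 0"
  then obtain a where "u = [:a:]" by (auto elim: degree_eq_zeroE)
  moreover have "D * v ^ 2 = u ^ 2 - 1"
    using sol by (simp add: pell_solution_def algebra_simps)
  ultimately have "D * v ^ 2 = [:a ^ 2 - 1:]" by (simp add: poly_const_pow one_pCons)
  moreover have "degree (D * v ^ 2) = degree D + degree (v ^ 2)"
    using D v by (intro degree_mult_eq) auto
  ultimately show False using D by simp
qed

text \<open>With \<open>r^2 = D(a)\<close>, the numbers \<open>z\<close> and \<open>w\<close> are
  the values of \<open>u + v * sqrt D\<close> and its conjugate: \<open>z * w = 1\<close>, and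
  \<open>v_m(a) = 0\<close> gives \<open>z^m = w^m\<close>, hence
  \<open>z^(2 * m) = 1\<close>.\<close>

lemma pell_v_root:
  assumes sol: "pell_solution D u v" and m: "m > 0" and a: "rat_eval (pell_v D u v m) a = 0"
  obtains n z where "primitive_root_of_unity n z" "rat_eval u a = joukowski z"
proof -
  let ?d = "rat_eval D a" and ?s = "rat_eval u a" and ?t = "rat_eval v a"
  define r where "r = csqrt ?d"
  have r: "r * r = ?d" by (simp add: r_def flip: power2_eq_square)
  define z w where "z = ?s + r * ?t" and "w = ?s - r * ?t"
  have "rat_eval (u ^ 2 - D * v ^ 2) a = 1" using sol by (simp add: pell_solution_def)
  then have "?s * ?s - ?d * ?t * ?t = 1" by (simp add: power2_eq_square algebra_simps)
  then have zw: "z * w = 1"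
    by (simp add: z_def w_def algebra_simps) (simp add: mult.assoc[symmetric] r)
  have pow: "z ^ k = rat_eval (pell_u D u v k) a + r * rat_eval (pell_v D u v k) a \<and>
      w ^ k = rat_eval (pell_u D u v k) a - r * rat_eval (pell_v D u v k) a" for k
  proof (induction k)
    case (Suc k)
    let ?U = "rat_eval (pell_u D u v k) a" and ?V = "rat_eval (pell_v D u v k) a"
    have "z ^ Suc k = (?U + r * ?V) * z" "w ^ Suc k = (?U - r * ?V) * w"
      using Suc by (simp_all add: mult.commute)
    then show ?case
      by (simp add: pell_Suc z_def w_def algebra_simps flip: r)
  qed (simp add: pell_0)
  have "z ^ m = w ^ m" using pow[of m] a by simp
  then have "z ^ (2 * m) = z ^ m * w ^ m" by (simp add: mult_2 power_add)
  also have "\<dots> = 1" using zw by (simp flip: power_mult_distrib)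
  finally obtain n where n: "primitive_root_of_unity n z"
    using primitive_root_of_unity_exists m by (metis mult_pos_pos zero_less_numeral)
  have "1 / z = w" using zw by (metis div_by_1 mult_zero_left nonzero_mult_div_cancel_left zero_neq_one)
  then have "rat_eval u a = joukowski z" by (simp add: joukowski_def z_def w_def)
  then show ?thesis using that n by blast
qed

text \<open>A root of \<open>P\<close> is a root of \<open>v_m\<close>, since the new part divides
  \<open>v_m\<close>. The index \<open>n\<close> is the order of the attached root of unity and may
  differ from \<open>m\<close>.\<close>

lemma pell_irred_subset:
  assumes D: "degree D > 0" and sol: "pell_solution D u v" and v: "v \<noteq> 0"
  shows "pell_irred D u v N \<subseteq> (\<Union>n\<in>{n. n > 0 \<and> totient n \<le> 2 * N}. joukowski_fiber u n)"
proof
  fix P assume "P \<in> pell_irred D u v N"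
  then obtain m where P: "lead_coeff P = 1" "irreducible P" "degree P \<le> N"
    and m: "m \<ge> 1" "P dvd pell_v_new D u v m"
    by (auto simp: pell_irred_def)
  have "pell_v_new D u v m dvd pell_v D u v m"
    unfolding pell_v_eq_prod_new[OF D sol v m(1)] using m(1) by (intro dvd_prodI) auto
  then have P_dvd: "P dvd pell_v D u v m" using m(2) by (rule dvd_trans[rotated])
  have "degree P > 0"
  proof (rule ccontr)
    assume "\<not> degree P > 0"
    then have "is_unit P" using P(2) by (intro is_unit_iff_degree[THEN iffD2]) auto
    then show False using P(2) by (simp add: irreducible_def)
  qed
  then obtain a where a: "rat_eval P a = 0" by (rule rat_eval_root_exists)
  obtain n z where "primitive_root_of_unity n z" "rat_eval u a = joukowski z"
    using pell_v_root[OF sol _ rat_eval_dvd[OF P_dvd a]] m(1) by auto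
  then have fiber: "P \<in> joukowski_fiber u n" using P a by (auto simp: joukowski_fiber_def)
  then show "P \<in> (\<Union>n\<in>{n. n > 0 \<and> totient n \<le> 2 * N}. joukowski_fiber u n)"
    using totient_le_degree_fiber[OF fiber] P(3) by auto
qed

theorem theorem0p2:
  fixes D u v :: "rat poly"
  assumes "degree D > 0"
    and "pell_fundamental (map_poly of_rat D :: complex poly) (map_poly of_rat u) (map_poly of_rat v)"
  shows "\<forall>\<^sub>F N in sequentially.
           finite (pell_irred D u v N) \<and> card (pell_irred D u v N) \<le> 10 * N * degree u"
proof -
  have sol: "pell_solution D u v" and v: "v \<noteq> 0"
    using assms(2) by (auto simp: pell_fundamental_def intro: pell_solution_rat)
  have u: "degree u > 0" using assms(1) sol v by (rule pell_solution_degree_pos)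
  obtain K where fin: "\<And>N. N > 0 \<Longrightarrow> finite {n. n > 0 \<and> totient n \<le> 2 * N}"
    and card: "\<And>N. N > 0 \<Longrightarrow> card {n. n > 0 \<and> totient n \<le> 2 * N} \<le> 91 / 10 * real N + K * sqrt N"
    using card_totient_le by blast
  show ?thesis
  proof (rule eventually_sequentiallyI)
    \<comment> \<open>This threshold gives \<open>2 * K <= sqrt N\<close>, so the error
      \<open>K * sqrt N\<close> is at most \<open>N / 2\<close> and the total
      \<open>(91/10 + 1/2) * N\<close> stays below \<open>10 * N\<close>. The \<open>Suc\<close>
      ensures \<open>N > 0\<close>.\<close>
    fix N :: nat assume N: "N \<ge> Suc (nat \<lceil>(2 * K)\<^sup>2\<rceil>)"
    let ?S = "{n. n > 0 \<and> totient n \<le> 2 * N}"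
    have "N > 0" using N by simp
    have "(2 * K)\<^sup>2 \<le> real N" using N by linarith
    then have "2 * K \<le> sqrt N" using real_le_rsqrt by blast
    then have "K * sqrt N \<le> sqrt N / 2 * sqrt N" by (intro mult_right_mono) auto
    then have "K * sqrt N \<le> real N / 2" by simp
    then have "real (card ?S) \<le> real (10 * N)" using card[OF \<open>N > 0\<close>] by simp
    then have S: "card ?S \<le> 10 * N" by (simp only: of_nat_le_iff)
    have fin_U: "finite (\<Union>n\<in>?S. joukowski_fiber u n)"
      using fin[OF \<open>N > 0\<close>] card_joukowski_fiber[OF u] by blast
    note sub = pell_irred_subset[OF assms(1) sol v, of N]
    have "card (pell_irred D u v N) \<le> card (\<Union>n\<in>?S. joukowski_fiber u n)"
      using fin_U sub by (rule card_mono)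
    also have "\<dots> \<le> (\<Sum>n\<in>?S. card (joukowski_fiber u n))"
      using fin[OF \<open>N > 0\<close>] by (rule card_UN_le)
    also have "\<dots> \<le> (\<Sum>n\<in>?S. degree u)"
      using card_joukowski_fiber[OF u] by (intro sum_mono) auto
    also have "\<dots> \<le> 10 * N * degree u" using S by simp
    finally show "finite (pell_irred D u v N) \<and> card (pell_irred D u v N) \<le> 10 * N * degree u"
      using finite_subset[OF sub fin_U] by blast
  qed
qed

end
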